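(* For each $n$ let $\boldsymbol d=\boldsymbol d^{(n)}=(d_1,\dots,d_n)$ be a sequence of positive integers with even sum, and let $D_n$ be the degree of a uniformly chosen vertex. Suppose that there is a random variable $D$ such that $D_n$ converges in distribution to $D$ as $n\to\infty$, that $\mathbb E[D_n]\to\mathbb E[D]<\infty$, and that $\lim_{n\to\infty}\mathbb E[D_n^3]=\mathbb E[D^3]<\infty$. Then, for the configuration model $\mathrm{CM}_n(\boldsymbol d)$, as $n\to\infty$, $$\mathbb P(S_n=0)=e^{-\lambda_n^{S}}+O(1/n),\qquad \mathbb P(M_n=0)=e^{-\lambda_n^{M}}+O(1/n),$$ and $$\mathbb P(S_n=M_n=0)=e^{-\lambda_n^{S}-\lambda_n^{M}}+O(1/n).$$ In particular, $$\mathbb P(\mathrm{CM}_n(\boldsymbol d)\text{ is simple})=e^{-\lambda_n^{S}-\lambda_n^{M}}+O(1/n).$$ Furthermore, if also $\lim_{n\to\infty}\mathbb E[D_n^4]=\mathbb E[D^4]<\infty$, then $\lambda_n^{S}=\nu_n/2+O(1/n)$ and $\lambda_n^{M}=\nu_n^2/4+O(1/n)$, so that all four displayed asymptotics hold with $\lambda_n^{S}$ and $\lambda_n^{M}$ replaced by $\nu_n/2$ and $\nu_n^2/4$, respectively.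
   Context: Configuration model: given positive integers $\boldsymbol d=(d_1,\dots,d_n)$ with even sum $\ell_n=\sum_{i\in[n]}d_i$, where $[n]=\{1,\dots,n\}$, attach $d_i$ half-edges to vertex $i$ for each $i\in[n]$, and match the $\ell_n$ half-edges in pairs uniformly at random; each pair forms an edge. The resulting random multigraph on $[n]$ is $\mathrm{CM}_n(\boldsymbol d)$. For $i,j\in[n]$, $X_{ij}$ is the number of edges between $i$ and $j$ ($X_{ii}$ is the number of self-loops at $i$). Define $$S_n=\sum_{i\in[n]}X_{ii},\qquad M_n=\sum_{1\le i<j\le n}\binom{X_{ij}}{2},\qquad \lambda_n^{S}=\mathbb E[S_n],\qquad \lambda_n^{M}=\mathbb E[M_n],\qquad \nu_n=\frac{\sum_{i\in[n]}d_i(d_i-1)}{\ell_n}.$$ The graph is simple if it has no self-loops and no multiple edges. The random variable $D_n=d_V$ with $V$ uniform on $[n]$ has distribution function $F_n(x)=\frac1n\sum_{j\in[n]}\mathbf 1\{d_j\le x\}$. $f(n)=O(g(n))$ means $g(n)>0$ and $\limsup_{n\to\infty}|f(n)|/g(n)<\infty$. *)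

theory Defs
  imports "HOL-Probability.Probability" "HOL-Library.Landau_Symbols"
begin

text \<open>
  A multigraph is the multiset of its edges. The edge between \<open>i\<close> and \<open>j\<close> is the set \<open>{i, j}\<close>,
  so a self-loop at \<open>i\<close> is the singleton \<open>{i}\<close>.
\<close>

type_synonym multigraph = "nat set multiset"

definition edge_count :: "multigraph \<Rightarrow> nat \<Rightarrow> nat \<Rightarrow> nat" where
  "edge_count G i j = count G {i, j}"

definition self_loops :: "nat \<Rightarrow> multigraph \<Rightarrow> nat" where
  "self_loops n G = (\<Sum>i=1..n. edge_count G i i)"

definition multi_edges :: "nat \<Rightarrow> multigraph \<Rightarrow> nat" where
  "multi_edges n G = (\<Sum>i=1..n. \<Sum>j=i+1..n. edge_count G i j choose 2)"

definition simple_multigraph :: "multigraph \<Rightarrow> bool" where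
  "simple_multigraph G \<longleftrightarrow> (\<forall>i. {i} \<notin># G) \<and> (\<forall>e. count G e \<le> 1)"

text \<open>The \<open>k\<close>-th half-edge at vertex \<open>i\<close> is the pair \<open>(i, k)\<close>.\<close>

definition half_edges :: "nat \<Rightarrow> (nat \<Rightarrow> nat) \<Rightarrow> (nat \<times> nat) set" where
  "half_edges n d = (SIGMA i:{1..n}. {..<d i})"

definition pairings :: "'a set \<Rightarrow> 'a set set set" where
  "pairings H = {P. partition_on H P \<and> (\<forall>e\<in>P. card e = 2)}"

definition multigraph_of_pairing :: "(nat \<times> nat) set set \<Rightarrow> multigraph" where
  "multigraph_of_pairing P = image_mset (\<lambda>e. fst ` e) (mset_set P)"

text \<open>
  This is the intended law only when the degree sum is even: otherwise there are no pairings,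
  and \<^const>\<open>pmf_of_set\<close> is unspecified on the empty set.
\<close>

definition configuration_model :: "nat \<Rightarrow> (nat \<Rightarrow> nat) \<Rightarrow> multigraph pmf" where
  "configuration_model n d =
     map_pmf multigraph_of_pairing (pmf_of_set (pairings (half_edges n d)))"

definition lambda_S :: "nat \<Rightarrow> (nat \<Rightarrow> nat) \<Rightarrow> real" where
  "lambda_S n d =
     measure_pmf.expectation (configuration_model n d) (\<lambda>G. real (self_loops n G))"

definition lambda_M :: "nat \<Rightarrow> (nat \<Rightarrow> nat) \<Rightarrow> real" where
  "lambda_M n d =
     measure_pmf.expectation (configuration_model n d) (\<lambda>G. real (multi_edges n G))"

definition nu :: "nat \<Rightarrow> (nat \<Rightarrow> nat) \<Rightarrow> real" where
  "nu n d = (\<Sum>i=1..n. real (d i) * (real (d i) - 1)) / real (\<Sum>i=1..n. d i)"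

definition prob_no_loops :: "nat \<Rightarrow> (nat \<Rightarrow> nat) \<Rightarrow> real" where
  "prob_no_loops n d = measure_pmf.prob (configuration_model n d) {G. self_loops n G = 0}"

definition prob_no_multi_edges :: "nat \<Rightarrow> (nat \<Rightarrow> nat) \<Rightarrow> real" where
  "prob_no_multi_edges n d = measure_pmf.prob (configuration_model n d) {G. multi_edges n G = 0}"

definition prob_neither :: "nat \<Rightarrow> (nat \<Rightarrow> nat) \<Rightarrow> real" where
  "prob_neither n d =
     measure_pmf.prob (configuration_model n d) {G. self_loops n G = 0 \<and> multi_edges n G = 0}"

definition prob_simple :: "nat \<Rightarrow> (nat \<Rightarrow> nat) \<Rightarrow> real" where
  "prob_simple n d = measure_pmf.prob (configuration_model n d) {G. simple_multigraph G}"

text \<open>Law and moments of the degree of a uniformly chosen vertex; meaningful for \<open>n \<ge> 1\<close>.\<close>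

definition degree_law :: "nat \<Rightarrow> (nat \<Rightarrow> nat) \<Rightarrow> real measure" where
  "degree_law n d = distr (measure_pmf (pmf_of_set {1..n})) borel (\<lambda>v. real (d v))"

definition degree_moment :: "nat \<Rightarrow> nat \<Rightarrow> (nat \<Rightarrow> nat) \<Rightarrow> real" where
  "degree_moment k n d = measure_pmf.expectation (pmf_of_set {1..n}) (\<lambda>v. real (d v) ^ k)"

end

theory Submission
  imports Defs "HOL-Combinatorics.Transposition"
begin

text \<open>
  Loops and pairs of parallel edges are both patterns, that is, fixed sets of disjoint pairs of
  half-edges that may or may not be contained in the random pairing. Let \<open>W\<close> be the number of
  patterns of a family \<open>A\<close> that occur, \<open>\<lambda> = E W\<close>, and \<open>g x = E (x ^ W)\<close>. Then \<open>g'\<close> is the sum over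
  \<open>a \<in> A\<close> of \<open>P (a occurs) * E (x ^ (W - 1) | a occurs)\<close>. Given that \<open>a\<close> occurs, the remaining half-edges
  are uniformly paired, and a switching argument shows that removing the half-edges of \<open>a\<close>
  hardly changes \<open>W\<close>. Hence \<open>g'\<close> is close to \<open>\<lambda> g\<close> on the unit interval, and integrating from \<open>g 1 = 1\<close>
  gives \<open>P (W = 0) = g 0 \<approx> exp (- \<lambda>)\<close>. The error involves the degrees only through \<open>\<Sum>d\<^sub>i\<^sup>2\<close> and
  \<open>\<Sum>d\<^sub>i\<^sup>3\<close>, which are \<open>O(n)\<close> under the third moment condition.
\<close>

section \<open>Averages over pairings\<close>

text \<open>Removing the half-edges of a pattern leaves a set that no longer comes from a degree
  sequence, so averages are taken over pairings of an arbitrary finite set, while the family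
  \<open>A\<close> stays fixed: a pattern that needs a removed half-edge simply never occurs. One
  pattern influences another in three ways: they may share an edge, they may compete for a
  half-edge, and the switch that reinserts a removed edge may break a pattern elsewhere. As a given
  edge has probability of order \<open>1 / n\<close>, these effects cost at most the order of
  \<open>(\<Sum>d_i ^ 3) ^ 2 / n ^ 3\<close>, \<open>\<Sum>d_i ^ 3 / n ^ 2\<close> and
  \<open>1 / n\<close>, so bounded third moments make each of them \<open>O(1 / n)\<close>. Loops,
  double edges and their union are three choices of \<open>A\<close>, so the joint statement needs
  no separate argument about the dependence of \<open>S_n\<close> and \<open>M_n\<close>. The fourth
  moment enters in comparing \<open>E M_n\<close> with \<open>nu ^ 2 / 4\<close>, where quadruples
  of half-edges at a single vertex have to be discarded.\<close>

lemma pairings_iff: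
  "P \<in> pairings H \<longleftrightarrow> \<Union>P = H \<and> disjoint P \<and> (\<forall>e\<in>P. card e = 2)"
  by (auto simp: pairings_def partition_on_def)

lemma pairings_edge_unique:
  "P \<in> pairings H \<Longrightarrow> e \<in> P \<Longrightarrow> f \<in> P \<Longrightarrow> h \<in> e \<Longrightarrow> h \<in> f \<Longrightarrow> e = f"
  unfolding pairings_iff by (auto dest: disjointD)

lemma finite_pairings: "finite H \<Longrightarrow> finite (pairings H)"
  by (rule finite_subset[of _ "Pow (Pow H)"]) (auto simp: pairings_iff)

lemma finite_pairing: "finite H \<Longrightarrow> P \<in> pairings H \<Longrightarrow> finite P"
  by (rule finite_subset[of _ "Pow H"]) (auto simp: pairings_iff)

lemma pairings_Un:
  assumes a: "disjoint a" "\<And>e. e \<in> a \<Longrightarrow> card e = 2 \<and> e \<subseteq> H"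
    and Q: "Q \<in> pairings (H - \<Union>a)"
  shows "a \<union> Q \<in> pairings H"
  using assms unfolding pairings_iff
  by (intro conjI disjoint_union) auto

lemma pairings_Diff:
  assumes P: "P \<in> pairings H" and "a \<subseteq> P"
  shows "P - a \<in> pairings (H - \<Union>a)"
proof -
  have "\<Union>(P - a) = H - \<Union>a"
  proof
    show "\<Union>(P - a) \<subseteq> H - \<Union>a"
      using assms pairings_edge_unique[OF P] by (fastforce simp: pairings_iff)
    show "H - \<Union>a \<subseteq> \<Union>(P - a)"
      using assms by (auto simp: pairings_iff)
  qed
  then show ?thesis
    using assms by (auto simp: pairings_iff intro: disjoint_def pairwise_subset)
qed

lemma pairings_disjoint_pattern:
  assumes "Q \<in> pairings (H - \<Union>a)" "\<And>e. e \<in> a \<Longrightarrow> card e = 2"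
  shows "a \<inter> Q = {}"
proof -
  have False if "e \<in> a" "e \<in> Q" for e
  proof -
    have "e \<subseteq> \<Union>a" "e \<subseteq> H - \<Union>a" using that assms by (auto simp: pairings_iff)
    then have "e = {}" by auto
    then show False using assms(2)[OF that(1)] by simp
  qed
  then show ?thesis by auto
qed

text \<open>The conditioning principle: given that \<open>a\<close> occurs, the rest of a uniform
  pairing is a uniform pairing of the half-edges outside \<open>a\<close>. Adding and deleting
  \<open>a\<close> are mutually inverse because an edge of a pairing of \<open>H - \<Union>a\<close>
  cannot be an edge of \<open>a\<close>.\<close>

lemma bij_betw_pairings_Un:
  assumes a: "disjoint a" "\<And>e. e \<in> a \<Longrightarrow> card e = 2 \<and> e \<subseteq> H"
  shows "bij_betw ((\<union>) a) (pairings (H - \<Union>a)) {P \<in> pairings H. a \<subseteq> P}"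
proof (rule bij_betw_byWitness[where f' = "\<lambda>P. P - a"])
  show "\<forall>Q\<in>pairings (H - \<Union>a). a \<union> Q - a = Q"
    using pairings_disjoint_pattern a(2) by blast
  show "\<forall>P\<in>{P \<in> pairings H. a \<subseteq> P}. a \<union> (P - a) = P" by auto
  show "(\<union>) a ` pairings (H - \<Union>a) \<subseteq> {P \<in> pairings H. a \<subseteq> P}"
    using pairings_Un[OF a] by auto
  show "(\<lambda>P. P - a) ` {P \<in> pairings H. a \<subseteq> P} \<subseteq> pairings (H - \<Union>a)"
    using pairings_Diff by auto
qed

lemma sum_pairings_containing:
  assumes a: "disjoint a" "\<And>e. e \<in> a \<Longrightarrow> card e = 2 \<and> e \<subseteq> H"
  shows "(\<Sum>P | P \<in> pairings H \<and> a \<subseteq> P. F P) = (\<Sum>Q\<in>pairings (H - \<Union>a). F (a \<union> Q))"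
  by (rule sum.reindex_bij_betw[OF bij_betw_pairings_Un[OF a], symmetric])

section \<open>Switching: exchanging the partners of two half-edges\<close>

abbreviation transpose_pairing :: "'a \<Rightarrow> 'a \<Rightarrow> 'a set set \<Rightarrow> 'a set set" where
  "transpose_pairing t u P \<equiv> (\<lambda>e. Transposition.transpose t u ` e) ` P"

lemma transpose_pairing_twice: "transpose_pairing t u (transpose_pairing t u P) = P"
  by (simp add: image_image)

lemma transpose_pairing_pairings:
  assumes P: "P \<in> pairings H" and tu: "t \<in> H" "u \<in> H"
  shows "transpose_pairing t u P \<in> pairings H"
proof -
  have inj: "inj (Transposition.transpose t u)" by (simp add: bij_is_inj)
  have "\<Union>(transpose_pairing t u P) = Transposition.transpose t u ` H"
    using P by (auto simp: pairings_iff)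
  moreover have "disjoint (transpose_pairing t u P)"
    using P unfolding pairings_iff disjoint_def
    by (fastforce dest: injD[OF inj])
  moreover have "card e = 2" if "e \<in> transpose_pairing t u P" for e
    using that P by (auto simp: pairings_iff card_image inj_on_subset[OF inj])
  ultimately show ?thesis
    using tu by (simp add: pairings_iff)
qed

text \<open>Relabelling by the transposition sends \<open>{s, t}\<close> to \<open>{s, u}\<close>
  and is its own inverse, so every partner of \<open>s\<close> is equally likely. The case
  \<open>t = u\<close>, where nothing moves, is included.\<close>

lemma bij_betw_transpose_pairing:
  assumes "s \<in> H" "t \<in> H" "u \<in> H" "s \<noteq> t" "s \<noteq> u"
  shows "bij_betw (transpose_pairing t u) {P \<in> pairings H. {s, t} \<in> P} {P \<in> pairings H. {s, u} \<in> P}"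
proof (rule bij_betw_byWitness[where f' = "transpose_pairing t u"])
  have e: "Transposition.transpose t u ` {s, t} = {s, u}" "Transposition.transpose t u ` {s, u} = {s, t}"
    using assms by auto
  show "transpose_pairing t u ` {P \<in> pairings H. {s, t} \<in> P} \<subseteq> {P \<in> pairings H. {s, u} \<in> P}"
  proof clarify
    fix P assume "P \<in> pairings H" "{s, t} \<in> P"
    then show "transpose_pairing t u P \<in> pairings H \<and> {s, u} \<in> transpose_pairing t u P"
      using transpose_pairing_pairings[of P H t u] assms imageI[of "{s, t}" P "(`) (Transposition.transpose t u)"] e
      by simp
  qed
  show "transpose_pairing t u ` {P \<in> pairings H. {s, u} \<in> P} \<subseteq> {P \<in> pairings H. {s, t} \<in> P}"
  proof clarify
    fix P assume "P \<in> pairings H" "{s, u} \<in> P"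
    then show "transpose_pairing t u P \<in> pairings H \<and> {s, t} \<in> transpose_pairing t u P"
      using transpose_pairing_pairings[of P H t u] assms imageI[of "{s, u}" P "(`) (Transposition.transpose t u)"] e
      by simp
  qed
qed (simp_all only: transpose_pairing_twice, simp_all)

lemma pairings_partition_by_partner:
  assumes "s \<in> H"
  shows "pairings H = (\<Union>u\<in>H - {s}. {P \<in> pairings H. {s, u} \<in> P})"
proof
  show "pairings H \<subseteq> (\<Union>u\<in>H - {s}. {P \<in> pairings H. {s, u} \<in> P})"
  proof
    fix P assume P: "P \<in> pairings H"
    then obtain e where e: "e \<in> P" "s \<in> e" "card e = 2" "e \<subseteq> H"
      using assms unfolding pairings_iff by auto
    then obtain u where "e = {s, u}" "u \<noteq> s"
      by (metis card_2_iff doubleton_eq_iff insertE singletonD)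
    then show "P \<in> (\<Union>u\<in>H - {s}. {P \<in> pairings H. {s, u} \<in> P})"
      using P e by auto
  qed
qed auto

text \<open>Transposing \<open>t\<close> with the partner \<open>u\<close> of \<open>s\<close> turns any pairing into one that contains \<open>{s, t}\<close>.\<close>

lemma sum_pairings_insert:
  assumes H: "finite H" and st: "s \<in> H" "t \<in> H" "s \<noteq> t"
  shows "(\<Sum>P\<in>pairings H. F P) =
    (\<Sum>Q\<in>pairings (H - {s, t}). \<Sum>u\<in>H - {s}. F (transpose_pairing t u (insert {s, t} Q)))"
proof -
  have "(\<Sum>P\<in>pairings H. F P) = (\<Sum>u\<in>H - {s}. \<Sum>P | P \<in> pairings H \<and> {s, u} \<in> P. F P)"
  proof (subst pairings_partition_by_partner[OF st(1)], rule sum.UNION_disjoint)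
    have "u = v" if "P \<in> pairings H" "{s, u} \<in> P" "{s, v} \<in> P" for P u v
      using pairings_edge_unique[OF that, of s] by (simp add: doubleton_eq_iff) metis
    then show "\<forall>u\<in>H - {s}. \<forall>v\<in>H - {s}. u \<noteq> v \<longrightarrow>
        {P \<in> pairings H. {s, u} \<in> P} \<inter> {P \<in> pairings H. {s, v} \<in> P} = {}"
      by blast
  qed (use H finite_pairings[OF H] in auto)
  also have "\<dots> = (\<Sum>u\<in>H - {s}. \<Sum>P | P \<in> pairings H \<and> {s, t} \<in> P. F (transpose_pairing t u P))"
    using st by (intro sum.cong refl sum.reindex_bij_betw[symmetric] bij_betw_transpose_pairing) auto
  also have "\<dots> = (\<Sum>u\<in>H - {s}. \<Sum>Q\<in>pairings (H - {s, t}). F (transpose_pairing t u (insert {s, t} Q)))"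
  proof (rule sum.cong[OF refl])
    fix u
    show "(\<Sum>P | P \<in> pairings H \<and> {s, t} \<in> P. F (transpose_pairing t u P)) =
        (\<Sum>Q\<in>pairings (H - {s, t}). F (transpose_pairing t u (insert {s, t} Q)))"
      using sum_pairings_containing[of "{{s, t}}" H "\<lambda>P. F (transpose_pairing t u P)"] st
      by simp
  qed
  also have "\<dots> = (\<Sum>Q\<in>pairings (H - {s, t}). \<Sum>u\<in>H - {s}. F (transpose_pairing t u (insert {s, t} Q)))"
    by (rule sum.swap)
  finally show ?thesis .
qed

text \<open>The switching identity for the constant function 1: each pairing of \<open>H - e\<close>
  gives rise to \<open>card H - 1\<close> pairings of \<open>H\<close>, one for each partner of a
  fixed element of \<open>e\<close>.\<close>

lemma card_pairings:
  assumes "finite H" "e \<subseteq> H" "card e = 2"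
  shows "card (pairings H) = (card H - 1) * card (pairings (H - e))"
proof -
  obtain s t where st: "e = {s, t}" "s \<noteq> t"
    using assms(3) by (metis card_2_iff)
  then show ?thesis
    using sum_pairings_insert[of H s t "\<lambda>_. 1 :: nat"] assms
    by (simp add: mult.commute)
qed

text \<open>Guards the averages below against being quotients \<open>0 / 0\<close>. Splitting off
  one pair at a time leads down to the empty set, which has exactly the empty pairing.\<close>

lemma card_pairings_pos:
  "finite H \<Longrightarrow> even (card H) \<Longrightarrow> card (pairings H) > 0"
proof (induction "card H" arbitrary: H rule: less_induct)
  case less
  show ?case
  proof (cases "H = {}")
    case True
    then have "pairings H = {{}}"
      by (auto simp: pairings_def partition_on_empty)
    then show ?thesis by simp
  next
    case False
    with less.prems have "card H \<ge> 2"
      using card_gt_0_iff[of H] by (cases "card H = 1") auto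
    then obtain e where e: "e \<subseteq> H" "card e = 2"
      by (metis obtain_subset_with_card_n)
    then have "card (H - e) = card H - 2"
      using less.prems by (simp add: card_Diff_subset finite_subset[of e H])
    then have "card (pairings (H - e)) > 0"
      using less \<open>card H \<ge> 2\<close> by (intro less.hyps) auto
    then show ?thesis
      using card_pairings[of H e] e less.prems \<open>card H \<ge> 2\<close> by simp
  qed
qed

text \<open>Expectation under a uniform pairing, as a plain finite sum. When there is no pairing,
  division by zero makes it 0, so linearity and monotonicity carry no parity condition; the average
  of a constant does.\<close>

definition pairing_avg :: "'a set \<Rightarrow> ('a set set \<Rightarrow> real) \<Rightarrow> real" where
  "pairing_avg H F = (\<Sum>P\<in>pairings H. F P) / real (card (pairings H))"

lemma pairing_avg_mono:
  "(\<And>P. P \<in> pairings H \<Longrightarrow> F P \<le> G P) \<Longrightarrow> pairing_avg H F \<le> pairing_avg H G"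
  by (simp add: pairing_avg_def divide_right_mono sum_mono)

lemma pairing_avg_nonneg:
  "(\<And>P. P \<in> pairings H \<Longrightarrow> F P \<ge> 0) \<Longrightarrow> pairing_avg H F \<ge> 0"
  by (simp add: pairing_avg_def sum_nonneg)

lemma pairing_avg_cong:
  "(\<And>P. P \<in> pairings H \<Longrightarrow> F P = G P) \<Longrightarrow> pairing_avg H F = pairing_avg H G"
  by (simp add: pairing_avg_def)

lemma pairing_avg_const:
  "finite H \<Longrightarrow> even (card H) \<Longrightarrow> pairing_avg H (\<lambda>_. c) = c"
  using card_pairings_pos[of H] by (simp add: pairing_avg_def)

lemma pairing_avg_sum:
  "pairing_avg H (\<lambda>P. \<Sum>a\<in>A. F a P) = (\<Sum>a\<in>A. pairing_avg H (F a))"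
  by (simp add: pairing_avg_def sum_divide_distrib sum.swap[of _ A])

lemma pairing_avg_add:
  "pairing_avg H (\<lambda>P. F P + G P) = pairing_avg H F + pairing_avg H G"
  by (simp add: pairing_avg_def sum.distrib add_divide_distrib)

lemma pairing_avg_diff:
  "pairing_avg H (\<lambda>P. F P - G P) = pairing_avg H F - pairing_avg H G"
  by (simp add: pairing_avg_def sum_subtractf diff_divide_distrib)

lemma pairing_avg_cmult:
  "pairing_avg H (\<lambda>P. c * F P) = c * pairing_avg H F"
  by (simp add: pairing_avg_def sum_distrib_left)

lemma pairing_avg_abs:
  "\<bar>pairing_avg H F\<bar> \<le> pairing_avg H (\<lambda>P. \<bar>F P\<bar>)"
  by (simp add: pairing_avg_def abs_divide divide_right_mono)

text \<open>A coupling: draw a uniform pairing \<open>Q\<close> of \<open>H - {s, t}\<close> and an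
  independent uniform \<open>u \<in> H - {s}\<close>, then switch \<open>t\<close> with
  \<open>u\<close> in \<open>insert {s, t} Q\<close>. The result is uniform on the pairings of
  \<open>H\<close> and differs from \<open>Q\<close> only in edges at \<open>s\<close>,
  \<open>t\<close> or \<open>u\<close>.\<close>

lemma pairing_avg_insert:
  assumes H: "finite H" "even (card H)" and st: "s \<in> H" "t \<in> H" "s \<noteq> t"
  shows "pairing_avg H F = pairing_avg (H - {s, t}) (\<lambda>Q.
    (\<Sum>u\<in>H - {s}. F (transpose_pairing t u (insert {s, t} Q))) / real (card H - 1))"
  using sum_pairings_insert[OF H(1) st, of F] card_pairings[of H "{s, t}"] assms
  by (simp add: pairing_avg_def sum_divide_distrib[symmetric] mult.commute)

lemma pairing_avg_containing:
  assumes H: "finite H" "even (card H)"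
    and a: "disjoint a" "\<And>e. e \<in> a \<Longrightarrow> card e = 2 \<and> e \<subseteq> H"
  shows "pairing_avg H (\<lambda>P. of_bool (a \<subseteq> P) * F P) =
    pairing_avg H (\<lambda>P. of_bool (a \<subseteq> P)) * pairing_avg (H - \<Union>a) (\<lambda>Q. F (a \<union> Q))"
proof -
  have fin: "finite (pairings H)" using finite_pairings H by auto
  have *: "(\<Sum>P\<in>pairings H. of_bool (a \<subseteq> P) * G P) = (\<Sum>Q\<in>pairings (H - \<Union>a). G (a \<union> Q))"
    for G :: "_ \<Rightarrow> real"
    using sum_pairings_containing[OF a, of G] fin
    by (simp add: of_bool_def if_distrib[of "\<lambda>x. x * _"] sum.If_cases Int_def cong: if_cong)
  show ?thesis
  proof (cases "card (pairings (H - \<Union>a)) = 0")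
    \<comment> \<open>If the remaining half-edges admit no pairing, the pattern never occurs and
      both sides are 0.\<close>
    case True
    moreover have "finite (pairings (H - \<Union>a))" using H by (simp add: finite_pairings)
    ultimately show ?thesis
      using *[of F] by (simp add: pairing_avg_def)
  next
    case False
    then show ?thesis
      using *[of F] *[of "\<lambda>_. 1"] by (simp add: pairing_avg_def)
  qed
qed

lemma pairing_avg_edge:
  assumes H: "finite H" "even (card H)" and e: "e \<subseteq> H" "card e = 2"
  shows "pairing_avg H (\<lambda>P. of_bool (e \<in> P) * F P) =
    pairing_avg (H - e) (\<lambda>Q. F (insert e Q)) / real (card H - 1)"
proof -
  have fin: "finite (pairings H)" using finite_pairings H by auto
  have "(\<Sum>P\<in>pairings H. of_bool (e \<in> P) * F P) = (\<Sum>Q\<in>pairings (H - e). F (insert e Q))"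
    using sum_pairings_containing[of "{e}" H F] fin e
    by (simp add: of_bool_def if_distrib[of "\<lambda>x. x * _"] sum.If_cases Int_def cong: if_cong)
  then show ?thesis
    using card_pairings[OF H(1) e] by (simp add: pairing_avg_def)
qed

text \<open>Reveal the edges of \<open>a\<close> one by one: with \<open>m\<close> half-edges left,
  an edge has probability \<open>1 / (m - 1)\<close>, and the worst factor is the last, where
  \<open>m = card H - 2 * card a + 2\<close>. Elements of \<open>a\<close> that are not pairs in
  \<open>H\<close>, or that meet earlier ones, only make the probability 0, so the bound also covers
  patterns using half-edges already removed.\<close>

lemma pairing_avg_subset_le:
  assumes "finite a" "finite H" "even (card H)" "2 * card a \<le> card H"
    and "1 / (real (card H) - 2 * real (card a) + 1) \<le> r"
  shows "pairing_avg H (\<lambda>P. of_bool (a \<subseteq> P)) \<le> r ^ card a"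
  using assms
proof (induction a arbitrary: H rule: finite_induct)
  case empty
  then show ?case by (simp add: pairing_avg_const)
next
  case (insert e a)
  have r: "r \<ge> 0"
  proof (rule order_trans)
    have "2 * real (card (insert e a)) \<le> real (card H)"
      using insert.prems(3) by linarith
    then show "0 \<le> 1 / (real (card H) - 2 * real (card (insert e a)) + 1)" by simp
  qed (rule insert.prems(4))
  show ?case
  proof (cases "card e = 2 \<and> e \<subseteq> H")
    case False
    then have "pairing_avg H (\<lambda>P. of_bool (insert e a \<subseteq> P)) = pairing_avg H (\<lambda>P. 0)"
      by (intro pairing_avg_cong) (auto simp: pairings_iff)
    then show ?thesis using r insert.prems by (simp add: pairing_avg_const)
  next
    case True
    have c: "card (H - e) = card H - 2"
      using True insert.prems by (simp add: card_Diff_subset finite_subset[of e H])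
    have c2: "card H \<ge> 2" using True insert.prems card_mono[of H e] by simp
    have "pairing_avg H (\<lambda>P. of_bool (insert e a \<subseteq> P)) =
        pairing_avg H (\<lambda>P. of_bool (e \<in> P) * of_bool (a \<subseteq> P))"
      by (intro pairing_avg_cong) auto
    also have "\<dots> = pairing_avg (H - e) (\<lambda>Q. of_bool (a \<subseteq> insert e Q)) / real (card H - 1)"
      using True insert.prems by (intro pairing_avg_edge) auto
    also have "pairing_avg (H - e) (\<lambda>Q. of_bool (a \<subseteq> insert e Q)) =
        pairing_avg (H - e) (\<lambda>Q. of_bool (a \<subseteq> Q))"
      using insert.hyps by (intro pairing_avg_cong) (auto simp: subset_insert)
    also have "\<dots> \<le> r ^ card a"
      using insert.prems insert.hyps c c2 by (intro insert.IH) (auto simp: of_nat_diff)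
    finally have "pairing_avg H (\<lambda>P. of_bool (insert e a \<subseteq> P)) \<le> r ^ card a / real (card H - 1)"
      by (simp add: divide_right_mono)
    also have "\<dots> \<le> r ^ card a * r"
    proof -
      have "1 / real (card H - 1) \<le> 1 / (real (card H) - 2 * real (card (insert e a)) + 1)"
        using insert.prems insert.hyps c2 by (intro divide_left_mono) (auto simp: of_nat_diff)
      also have "\<dots> \<le> r" by fact
      finally show ?thesis
        using mult_left_mono[of "1 / real (card H - 1)" r "r ^ card a"] r by simp
    qed
    finally show ?thesis using insert.hyps by (simp add: mult.commute)
  qed
qed

section \<open>Removing an edge\<close>

text \<open>\<open>A\<close> is not tied to the ground set of \<open>P\<close>, so the same count
  makes sense for pairings of \<open>H\<close> and of its subsets.\<close>

definition pattern_count :: "'a set set set \<Rightarrow> 'a set set \<Rightarrow> nat" where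
  "pattern_count A P = card {b \<in> A. b \<subseteq> P}"

lemma pattern_count_sum:
  "finite A \<Longrightarrow> real (pattern_count A P) = (\<Sum>b\<in>A. of_bool (b \<subseteq> P))"
  by (simp add: pattern_count_def of_bool_def sum.If_cases Int_def)

text \<open>The power is 1-Lipschitz in the exponent, uniformly in \<open>x\<close>, so a coupling
  bound on \<open>W\<close> transfers to \<open>E (x ^ W)\<close>. The core is
  \<open>1 - x ^ j \<le> j\<close>, clear for \<open>j \<ge> 1\<close> because the left side is at
  most 1.\<close>

lemma power_diff_le:
  fixes x :: real
  assumes "0 \<le> x" "x \<le> 1"
  shows "\<bar>x ^ m - x ^ n\<bar> \<le> \<bar>real m - real n\<bar>"
proof -
  have *: "\<bar>x ^ m - x ^ n\<bar> \<le> \<bar>real m - real n\<bar>" if "m \<le> n" for m n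
  proof -
    have "1 - x ^ j \<le> real j" for j
    proof (cases j)
      case (Suc i)
      have "0 \<le> x ^ j" using assms by simp
      then show ?thesis using Suc by simp
    qed simp
    moreover have "x ^ m - x ^ n = x ^ m * (1 - x ^ (n - m))"
      using that by (simp add: algebra_simps flip: power_add)
    moreover have "x ^ m * (1 - x ^ (n - m)) \<le> 1 * (1 - x ^ (n - m))"
      using assms by (intro mult_right_mono) (auto simp: power_le_one)
    moreover have "0 \<le> x ^ m * (1 - x ^ (n - m))"
      using assms by (auto simp: power_le_one)
    moreover have "1 - x ^ (n - m) \<le> real (n - m)" using calculation(1) .
    ultimately have "0 \<le> x ^ m - x ^ n" "x ^ m - x ^ n \<le> real (n - m)"
      by (simp, smt (verit))
    then show ?thesis using that by (simp add: of_nat_diff)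
  qed
  show ?thesis using *[of m n] *[of n m] by (cases "m \<le> n") (auto simp: abs_minus_commute)
qed

lemma abs_card_diff_le:
  assumes "finite X" "finite Y" "X - Y \<subseteq> U" "Y - X \<subseteq> V" "finite U" "finite V"
  shows "\<bar>real (card X) - real (card Y)\<bar> \<le> real (card U) + real (card V)"
proof -
  have "card X \<le> card Y + card U"
    using assms card_mono[of "Y \<union> U" X] card_Un_le[of Y U] by fastforce
  moreover have "card Y \<le> card X + card V"
    using assms card_mono[of "X \<union> V" Y] card_Un_le[of X V] by fastforce
  ultimately show ?thesis by linarith
qed


text \<open>The switch creates at most two edges: \<open>{s, u}\<close>, and the edge joining
  \<open>t\<close> to the former partner of \<open>u\<close>. Each contains \<open>s\<close> or
  \<open>t\<close>, so a pattern that newly occurs must use one of them.\<close>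

lemma pattern_transpose_new:
  assumes b: "b \<subseteq> transpose_pairing t u (insert {s, t} Q)" "\<not> b \<subseteq> Q" and "u \<noteq> s" "s \<noteq> t" "t \<notin> \<Union>Q"
  shows "\<Union>b \<inter> {s, t} \<noteq> {}"
proof -
  obtain f where f: "f \<in> insert {s, t} Q" "Transposition.transpose t u ` f \<in> b"
      "Transposition.transpose t u ` f \<notin> Q"
    using b by blast
  have "s \<in> Transposition.transpose t u ` f \<or> t \<in> Transposition.transpose t u ` f"
  proof (cases "f = {s, t}")
    case True
    then show ?thesis using assms by auto
  next
    case False
    then have "f \<in> Q" "t \<notin> f" using f assms by auto
    show ?thesis
    proof (cases "u \<in> f")
      case True
      then show ?thesis by (metis imageI transpose_apply_second)
    next
      case False
      then have "Transposition.transpose t u ` f = f"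
        using \<open>t \<notin> f\<close> by (force simp: transpose_def image_iff)
      then show ?thesis using f \<open>f \<in> Q\<close> by simp
    qed
  qed
  then show ?thesis using f by auto
qed

text \<open>The only edge of \<open>Q\<close> that the switch can destroy is the one at
  \<open>u\<close>.\<close>

lemma pattern_transpose_lost:
  assumes b: "b \<subseteq> Q" "\<not> b \<subseteq> transpose_pairing t u (insert {s, t} Q)" and "t \<notin> \<Union>Q"
  shows "u \<in> \<Union>b"
proof -
  obtain f where f: "f \<in> b" "f \<notin> transpose_pairing t u Q"
    using b by blast
  show ?thesis
  proof (cases "u \<in> f")
    case False
    moreover have "t \<notin> f" using f b assms(3) by auto
    ultimately have "Transposition.transpose t u ` f = f"
      by (force simp: transpose_def image_iff)
    then show ?thesis using f b by (metis imageI subsetD)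
  qed (use f in auto)
qed

lemma abs_pattern_count_transpose_diff_le:
  assumes "finite A" "t \<notin> \<Union>Q" "u \<noteq> s" "s \<noteq> t"
  defines "P \<equiv> transpose_pairing t u (insert {s, t} Q)"
  shows "\<bar>real (pattern_count A P) - real (pattern_count A Q)\<bar>
    \<le> real (pattern_count {b \<in> A. \<Union>b \<inter> {s, t} \<noteq> {}} P) + real (pattern_count {b \<in> A. u \<in> \<Union>b} Q)"
  unfolding pattern_count_def
proof (rule abs_card_diff_le)
  show "{b \<in> A. b \<subseteq> P} - {b \<in> A. b \<subseteq> Q} \<subseteq> {b \<in> {b \<in> A. \<Union>b \<inter> {s, t} \<noteq> {}}. b \<subseteq> P}"
    using pattern_transpose_new[of _ t u s Q] assms unfolding P_def by blast
  show "{b \<in> A. b \<subseteq> Q} - {b \<in> A. b \<subseteq> P} \<subseteq> {b \<in> {b \<in> A. u \<in> \<Union>b}. b \<subseteq> Q}"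
    using pattern_transpose_lost[of _ Q t u s] assms unfolding P_def by blast
qed (use assms in auto)

text \<open>Double counting: an occurring pattern is charged once for each of its at most
  \<open>m\<close> half-edges. Divided by the number of choices of \<open>u\<close>, this shows that
  a random switch destroys few patterns.\<close>

lemma sum_pattern_count_containing_le:
  assumes A: "finite A" "\<And>b. b \<in> A \<Longrightarrow> finite (\<Union>b) \<and> card (\<Union>b) \<le> m" and "finite H"
  shows "(\<Sum>u\<in>H. real (pattern_count {b \<in> A. u \<in> \<Union>b} Q)) \<le> real m * real (pattern_count A Q)"
proof -
  have "real (pattern_count {b \<in> A. u \<in> \<Union>b} Q) = (\<Sum>b\<in>A. of_bool (u \<in> \<Union>b) * of_bool (b \<subseteq> Q))" for u
    using A(1) by (simp add: pattern_count_sum sum.inter_filter of_bool_def if_distrib[of "\<lambda>x. x * _"] cong: if_cong)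
  then have "(\<Sum>u\<in>H. real (pattern_count {b \<in> A. u \<in> \<Union>b} Q)) =
      (\<Sum>b\<in>A. \<Sum>u\<in>H. of_bool (u \<in> \<Union>b) * of_bool (b \<subseteq> Q))"
    by (simp only: sum.swap[of _ H A])
  also have "\<dots> = (\<Sum>b\<in>A. real (card {u \<in> H. u \<in> \<Union>b}) * of_bool (b \<subseteq> Q))"
    using assms(3) by (intro sum.cong refl)
      (simp add: of_bool_def sum.If_cases Int_def flip: sum_distrib_right)
  also have "\<dots> \<le> (\<Sum>b\<in>A. real m * of_bool (b \<subseteq> Q))"
  proof (intro sum_mono mult_right_mono)
    fix b assume "b \<in> A"
    then have "card {u \<in> H. u \<in> \<Union>b} \<le> card (\<Union>b)" "card (\<Union>b) \<le> m"
      using A by (auto intro: card_mono)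
    then show "real (card {u \<in> H. u \<in> \<Union>b}) \<le> real m" by linarith
  qed auto
  also have "\<dots> = real m * real (pattern_count A Q)"
    using A by (simp add: pattern_count_sum sum_distrib_left)
  finally show ?thesis .
qed

text \<open>The two pairings are coupled by a random switch. Gained patterns meet \<open>e\<close>;
  lost patterns use the random \<open>u\<close>, which costs the factor
  \<open>m / (card H - 1)\<close>.\<close>

lemma pairing_avg_power_remove_edge:
  fixes x :: real
  assumes H: "finite H" "even (card H)" and e: "e \<subseteq> H" "card e = 2"
    and A: "finite A" "\<And>b. b \<in> A \<Longrightarrow> finite (\<Union>b) \<and> card (\<Union>b) \<le> m"
    and x: "0 \<le> x" "x \<le> 1"
  shows "\<bar>pairing_avg H (\<lambda>P. x ^ pattern_count A P) - pairing_avg (H - e) (\<lambda>P. x ^ pattern_count A P)\<bar>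
    \<le> pairing_avg H (\<lambda>P. real (pattern_count {b \<in> A. \<Union>b \<inter> e \<noteq> {}} P))
      + real m / real (card H - 1) * pairing_avg (H - e) (\<lambda>P. real (pattern_count A P))"
proof -
  obtain s t where st: "e = {s, t}" "s \<noteq> t" using e by (metis card_2_iff)
  have stH: "s \<in> H" "t \<in> H" using e st by auto
  define c where "c = real (card H - 1)"
  have "card H \<ge> 2" using card_mono[OF H(1) e(1)] e by simp
  then have c: "c > 0" "card (H - {s}) = card H - 1" "real (card H - 1) = c"
    using H stH by (auto simp: c_def)
  let ?W = "\<lambda>P. x ^ pattern_count A P"
  let ?T = "\<lambda>Q u. transpose_pairing t u (insert {s, t} Q)"
  let ?B = "{b \<in> A. \<Union>b \<inter> e \<noteq> {}}"
  have "pairing_avg H ?W - pairing_avg (H - e) ?W =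
      pairing_avg (H - e) (\<lambda>Q. (\<Sum>u\<in>H - {s}. ?W (?T Q u) - ?W Q) / c)"
    unfolding pairing_avg_insert[OF H stH st(2), of ?W] st(1)[symmetric] c(3)
      pairing_avg_diff[symmetric]
    using c by (simp add: sum_subtractf diff_divide_distrib)
  also have "\<bar>\<dots>\<bar> \<le> pairing_avg (H - e) (\<lambda>Q. \<bar>(\<Sum>u\<in>H - {s}. ?W (?T Q u) - ?W Q) / c\<bar>)"
    by (rule pairing_avg_abs)
  also have "\<dots> \<le> pairing_avg (H - e) (\<lambda>Q. (\<Sum>u\<in>H - {s}. real (pattern_count ?B (?T Q u))) / c
      + (real m / c) * real (pattern_count A Q))"
  proof (rule pairing_avg_mono)
    fix Q assume Q: "Q \<in> pairings (H - e)"
    then have t: "t \<notin> \<Union>Q" using st by (auto simp: pairings_iff)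
    have "\<bar>\<Sum>u\<in>H - {s}. ?W (?T Q u) - ?W Q\<bar> \<le> (\<Sum>u\<in>H - {s}. \<bar>?W (?T Q u) - ?W Q\<bar>)"
      by (rule sum_abs)
    also have "\<dots> \<le> (\<Sum>u\<in>H - {s}. real (pattern_count ?B (?T Q u))
        + real (pattern_count {b \<in> A. u \<in> \<Union>b} Q))"
      using power_diff_le[OF x] abs_pattern_count_transpose_diff_le[OF A(1) t _ st(2)]
      unfolding st(1) by (intro sum_mono order_trans[OF power_diff_le[OF x]]) blast
    also have "\<dots> \<le> (\<Sum>u\<in>H - {s}. real (pattern_count ?B (?T Q u))) + real m * real (pattern_count A Q)"
      using sum_pattern_count_containing_le[OF A, of "H - {s}" Q] H by (simp add: sum.distrib)
    finally show "\<bar>(\<Sum>u\<in>H - {s}. ?W (?T Q u) - ?W Q) / c\<bar> \<le>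
        (\<Sum>u\<in>H - {s}. real (pattern_count ?B (?T Q u))) / c + (real m / c) * real (pattern_count A Q)"
      using c by (simp add: abs_divide divide_simps)
  qed
  \<comment> \<open>The switched pairing is uniform on the pairings of \<open>H\<close>, so the
    coupling read backwards turns the gained patterns into an average over \<open>H\<close>. This
    works because they were counted in the switched pairing and not in \<open>Q\<close>.\<close>
  also have "\<dots> = pairing_avg H (\<lambda>P. real (pattern_count ?B P))
      + real m / c * pairing_avg (H - e) (\<lambda>P. real (pattern_count A P))"
    unfolding pairing_avg_insert[OF H stH st(2), of "\<lambda>P. real (pattern_count ?B P)"]
      st(1)[symmetric] c(3) pairing_avg_add pairing_avg_cmult ..
  finally show ?thesis unfolding c_def .
qed

section \<open>Poisson approximation for patterns\<close>

text \<open>The \<open>4 * k\<close> half-edges cover the at most \<open>2 * k\<close> removed by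
  conditioning on one pattern and the at most \<open>2 * k\<close> of a second one whose probability
  is then bounded. The antichain condition makes \<open>b - a\<close> nonempty for distinct
  patterns, so that an overlap still costs at least one factor \<open>rate\<close>.\<close>

locale pairing_patterns =
  fixes H :: "'a set" and A :: "'a set set set" and k :: nat
  assumes finite_H: "finite H" and even_H: "even (card H)" and finite_A: "finite A"
    and large_H: "4 * k \<le> card H"
    and pattern: "\<And>a. a \<in> A \<Longrightarrow> finite a \<and> a \<noteq> {} \<and> card a \<le> k \<and> disjoint a"
    and edge: "\<And>a e. a \<in> A \<Longrightarrow> e \<in> a \<Longrightarrow> card e = 2 \<and> e \<subseteq> H"
    and antichain: "\<And>a b. a \<in> A \<Longrightarrow> b \<in> A \<Longrightarrow> b \<subseteq> a \<Longrightarrow> b = a"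
begin

text \<open>
  Bounds the probability of a given edge after the half-edges of one pattern (at most \<open>2 k\<close>) have
  been removed and up to \<open>k - 1\<close> further edges have been revealed.
\<close>

definition rate :: real where
  "rate = 1 / (real (card H) - 4 * real k + 1)"

text \<open>For \<open>B \<subseteq> A\<close>, an upper bound on the expected number of occurring
  patterns of \<open>B\<close>, valid on \<open>H\<close> and still valid when one pattern's
  half-edges are removed.\<close>

definition weight :: "'a set set set \<Rightarrow> real" where
  "weight B = (\<Sum>b\<in>B. rate ^ card b)"

definition touching :: "'a \<Rightarrow> real" where
  "touching h = weight {b \<in> A. h \<in> \<Union>b}"

text \<open>Bounds the expected number of further patterns sharing an edge with \<open>a\<close>,
  given that \<open>a\<close> occurs: only the edges in \<open>b - a\<close> remain to be
  realised.\<close>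

definition overlap :: "'a set set \<Rightarrow> real" where
  "overlap a = (\<Sum>b | b \<in> A \<and> b \<noteq> a \<and> b \<inter> a \<noteq> {}. rate ^ card (b - a))"

definition mean :: real where
  "mean = pairing_avg H (\<lambda>P. real (pattern_count A P))"

section \<open>Bounds that survive the removal of half-edges\<close>

lemma large_H_real: "4 * real k \<le> real (card H)"
  using large_H by linarith

lemma rate_pos: "rate > 0"
  using large_H_real by (auto simp: rate_def divide_simps)

lemma weight_nonneg: "weight B \<ge> 0"
  using rate_pos by (simp add: weight_def sum_nonneg)

lemma weight_mono: "B \<subseteq> C \<Longrightarrow> finite C \<Longrightarrow> weight B \<le> weight C"
  using rate_pos by (auto simp: weight_def intro!: sum_mono2)

lemma touching_nonneg: "touching h \<ge> 0"
  by (simp add: touching_def weight_nonneg)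

lemma card_Union_edges:
  assumes "finite a" "disjoint a" "\<And>e. e \<in> a \<Longrightarrow> card e = 2"
  shows "finite (\<Union>a)" "card (\<Union>a) = 2 * card a"
proof -
  have fin: "finite e" if "e \<in> a" for e
    using assms(3)[OF that] by (metis card.infinite zero_neq_numeral)
  then show "finite (\<Union>a)" using assms by auto
  have "card (\<Union>a) = sum card a"
    using assms fin by (intro card_Union_disjoint) auto
  then show "card (\<Union>a) = 2 * card a" using assms by simp
qed

lemma pattern_Union: "a \<in> A \<Longrightarrow> finite (\<Union>a)" "a \<in> A \<Longrightarrow> card (\<Union>a) = 2 * card a"
  using card_Union_edges[of a] pattern[of a] edge[of a] by auto

text \<open>At most \<open>2 * k\<close> half-edges are missing and \<open>b\<close> uses at most
  \<open>2 * k\<close> more, so even the last edge of \<open>b\<close> to be revealed has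
  conditional probability at most \<open>rate\<close>.\<close>

lemma avg_contains_le:
  assumes H': "H' \<subseteq> H" "even (card H')" "card H \<le> card H' + 2 * k"
    and b: "finite b" "card b \<le> k"
  shows "pairing_avg H' (\<lambda>P. of_bool (b \<subseteq> P)) \<le> rate ^ card b"
proof (rule pairing_avg_subset_le)
  show "finite H'" using H' finite_H finite_subset by auto
  have "real (card H) \<le> real (card H') + 2 * real k" "real (card b) \<le> real k"
    using H' b by linarith+
  then show "1 / (real (card H') - 2 * real (card b) + 1) \<le> rate"
    unfolding rate_def using large_H_real by (intro divide_left_mono) auto
  show "2 * card b \<le> card H'" using H' b large_H by linarith
qed (use H' b in auto)

lemma avg_pattern_count_le:
  assumes H': "H' \<subseteq> H" "even (card H')" "card H \<le> card H' + 2 * k" and "B \<subseteq> A"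
  shows "pairing_avg H' (\<lambda>P. real (pattern_count B P)) \<le> weight B"
proof -
  have "finite B" using finite_A assms finite_subset by auto
  then show ?thesis
    unfolding weight_def pattern_count_sum[OF \<open>finite B\<close>] pairing_avg_sum using pattern assms
    by (intro sum_mono avg_contains_le[OF H']) auto
qed

lemma weight_touching_edge_le:
  assumes "finite e"
  shows "weight {b \<in> A. \<Union>b \<inter> e \<noteq> {}} \<le> (\<Sum>h\<in>e. touching h)"
  using assms
proof (induction e rule: finite_induct)
  case empty
  then show ?case by (simp add: weight_def)
next
  case (insert h e)
  have "{b \<in> A. \<Union>b \<inter> insert h e \<noteq> {}} = {b \<in> A. h \<in> \<Union>b} \<union> {b \<in> A. \<Union>b \<inter> e \<noteq> {}}" by auto
  then have "weight {b \<in> A. \<Union>b \<inter> insert h e \<noteq> {}} \<le> touching h + weight {b \<in> A. \<Union>b \<inter> e \<noteq> {}}"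
    using finite_A rate_pos by (simp add: touching_def weight_def sum_Un sum_nonneg)
  then show ?case using insert by simp
qed

text \<open>Telescoping over the edges of \<open>a\<close>. The cardinality condition is a budget:
  each step uses up two half-edges, and at every stage at most \<open>2 * k\<close> are missing from
  \<open>H\<close>, so \<open>rate\<close> applies throughout.\<close>

lemma avg_power_remove_edges:
  fixes x :: real
  assumes "0 \<le> x" "x \<le> 1" and "finite a"
    and "H' \<subseteq> H" "even (card H')" "card H + 2 * card a \<le> card H' + 2 * k"
    and "disjoint a" "\<And>e. e \<in> a \<Longrightarrow> card e = 2 \<and> e \<subseteq> H'"
  shows "\<bar>pairing_avg H' (\<lambda>P. x ^ pattern_count A P) - pairing_avg (H' - \<Union>a) (\<lambda>P. x ^ pattern_count A P)\<bar>
    \<le> (\<Sum>h\<in>\<Union>a. touching h) + real (card a) * (2 * real k * rate * weight A)"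
  using assms(3-)
proof (induction a arbitrary: H' rule: finite_induct)
  case empty
  then show ?case by simp
next
  case (insert e a)
  let ?W = "\<lambda>P. x ^ pattern_count A P"
  have e: "card e = 2" "e \<subseteq> H'" and fin: "finite H'" "finite e"
    using insert.prems finite_H finite_subset by (auto intro: finite_subset)
  have disj: "e \<inter> \<Union>a = {}" "disjoint a"
    using insert.prems insert.hyps by (auto simp: disjoint_def)
  have c: "card (H' - e) = card H' - 2" "card H' \<ge> 2"
    using e fin card_mono[OF fin(1) e(2)] by (simp_all add: card_Diff_subset)
  have "real (card H) \<le> real (card H' - 1) - 1 + 2 * real k"
    using insert.prems(3) c insert.hyps by (simp add: of_nat_diff)
  then have r: "1 / real (card H' - 1) \<le> rate"
    unfolding rate_def using large_H_real c by (intro divide_left_mono) auto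
  have U: "finite (\<Union>b) \<and> card (\<Union>b) \<le> 2 * k" if "b \<in> A" for b
    using pattern_Union[OF that] pattern[OF that] by simp
  have "\<bar>pairing_avg H' ?W - pairing_avg (H' - e) ?W\<bar>
      \<le> pairing_avg H' (\<lambda>P. real (pattern_count {b \<in> A. \<Union>b \<inter> e \<noteq> {}} P))
        + real (2 * k) / real (card H' - 1) * pairing_avg (H' - e) (\<lambda>P. real (pattern_count A P))"
    by (rule pairing_avg_power_remove_edge) (use fin e insert.prems finite_A U assms in auto)
  also have "\<dots> \<le> weight {b \<in> A. \<Union>b \<inter> e \<noteq> {}} + (2 * real k * rate) * weight A"
  proof (intro add_mono mult_mono)
    show "pairing_avg H' (\<lambda>P. real (pattern_count {b \<in> A. \<Union>b \<inter> e \<noteq> {}} P)) \<le> weight {b \<in> A. \<Union>b \<inter> e \<noteq> {}}"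
      using insert.prems by (intro avg_pattern_count_le) auto
    show "pairing_avg (H' - e) (\<lambda>P. real (pattern_count A P)) \<le> weight A"
      using insert.prems insert.hyps c by (intro avg_pattern_count_le) auto
    show "real (2 * k) / real (card H' - 1) \<le> 2 * real k * rate"
      using mult_left_mono[OF r, of "2 * real k"] by simp
  qed (use rate_pos in \<open>auto intro: pairing_avg_nonneg\<close>)
  also have "\<dots> \<le> (\<Sum>h\<in>e. touching h) + 2 * real k * rate * weight A"
    using weight_touching_edge_le[OF fin(2)] by simp
  finally have 1: "\<bar>pairing_avg H' ?W - pairing_avg (H' - e) ?W\<bar> \<le> (\<Sum>h\<in>e. touching h) + 2 * real k * rate * weight A" .
  have 2: "\<bar>pairing_avg (H' - e) ?W - pairing_avg (H' - e - \<Union>a) ?W\<bar>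
      \<le> (\<Sum>h\<in>\<Union>a. touching h) + real (card a) * (2 * real k * rate * weight A)"
  proof (rule insert.IH)
    show "card f = 2 \<and> f \<subseteq> H' - e" if "f \<in> a" for f
      using insert.prems(5)[of f] that disj by auto
  qed (use insert.prems insert.hyps c disj in auto)
  have "(\<Sum>h\<in>\<Union>(insert e a). touching h) = (\<Sum>h\<in>e. touching h) + (\<Sum>h\<in>\<Union>a. touching h)"
    using disj fin insert.prems(5) insert.hyps
    by (simp, intro sum.union_disjoint) (auto intro: finite_subset[OF _ fin(1)])
  moreover have "H' - e - \<Union>a = H' - \<Union>(insert e a)" by auto
  ultimately show ?case
    using 1 2 insert.hyps by (simp add: algebra_simps)
qed

text \<open>Passing from the count on \<open>a \<union> Q\<close> to that on \<open>Q\<close> loses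
  \<open>a\<close> itself, which the \<open>- 1\<close> absorbs, and the other occurring patterns
  that share an edge with \<open>a\<close>.\<close>

lemma avg_power_shift:
  fixes x :: real
  assumes x: "0 \<le> x" "x \<le> 1" and a: "a \<in> A"
  shows "\<bar>pairing_avg (H - \<Union>a) (\<lambda>Q. x ^ (pattern_count A (a \<union> Q) - 1))
      - pairing_avg (H - \<Union>a) (\<lambda>Q. x ^ pattern_count A Q)\<bar> \<le> overlap a"
proof -
  let ?B = "{b. b \<in> A \<and> b \<noteq> a \<and> b \<inter> a \<noteq> {}}"
  have finB: "finite ?B" using finite_A by simp
  have "\<bar>x ^ (pattern_count A (a \<union> Q) - 1) - x ^ pattern_count A Q\<bar> \<le> (\<Sum>b\<in>?B. of_bool (b - a \<subseteq> Q))"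
    if Q: "Q \<in> pairings (H - \<Union>a)" for Q
  proof -
    have disj: "a \<inter> Q = {}" using pairings_disjoint_pattern[OF Q] edge[OF a] by auto
    have "{b \<in> A. b \<subseteq> a \<union> Q} = insert a {b \<in> A - {a}. b \<subseteq> a \<union> Q}" using a by auto
    then have "pattern_count A (a \<union> Q) - 1 = card {b \<in> A - {a}. b \<subseteq> a \<union> Q}"
      using finite_A by (simp add: pattern_count_def)
    then have "\<bar>real (pattern_count A (a \<union> Q) - 1) - real (pattern_count A Q)\<bar>
        = \<bar>real (card {b \<in> A - {a}. b \<subseteq> a \<union> Q}) - real (card {b \<in> A. b \<subseteq> Q})\<bar>"
      by (simp add: pattern_count_def)
    \<comment> \<open>The second set is empty: a pattern contained in \<open>Q\<close> is also
      contained in \<open>a \<union> Q\<close>, and it is not \<open>a\<close>, which is nonempty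
      and disjoint from \<open>Q\<close>.\<close>
    also have "\<dots> \<le> real (card {b \<in> ?B. b - a \<subseteq> Q}) + real (card {b. b \<in> A \<and> False})"
      using finite_A disj pattern[OF a] by (intro abs_card_diff_le) auto
    also have "\<dots> = (\<Sum>b\<in>?B. of_bool (b - a \<subseteq> Q))"
      using finB by (simp add: of_bool_def sum.If_cases Int_def conj_ac)
    finally show ?thesis using power_diff_le[OF x] by (rule order_trans[rotated])
  qed
  then have "\<bar>pairing_avg (H - \<Union>a) (\<lambda>Q. x ^ (pattern_count A (a \<union> Q) - 1))
      - pairing_avg (H - \<Union>a) (\<lambda>Q. x ^ pattern_count A Q)\<bar>
      \<le> pairing_avg (H - \<Union>a) (\<lambda>Q. \<Sum>b\<in>?B. of_bool (b - a \<subseteq> Q))"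
    unfolding pairing_avg_diff[symmetric]
    by (intro order_trans[OF pairing_avg_abs] pairing_avg_mono)
  also have "\<dots> = (\<Sum>b\<in>?B. pairing_avg (H - \<Union>a) (\<lambda>Q. of_bool (b - a \<subseteq> Q)))"
    by (rule pairing_avg_sum)
  also have "\<dots> \<le> overlap a"
    unfolding overlap_def
  proof (intro sum_mono avg_contains_le)
    have "card (H - \<Union>a) = card H - 2 * card a"
      using pattern_Union[OF a] edge[OF a] by (subst card_Diff_subset) auto
    moreover have "card a \<le> k" using pattern[OF a] by simp
    ultimately show "card H \<le> card (H - \<Union>a) + 2 * k" "even (card (H - \<Union>a))"
      using even_H large_H by auto
    fix b assume "b \<in> ?B"
    then show "finite (b - a)" "card (b - a) \<le> k"
      using pattern[of b] card_Diff1_le order_trans[OF card_mono[of b "b - a"]] by auto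
  qed auto
  finally show ?thesis .
qed

text \<open>One term for each kind of dependence: patterns competing for a half-edge; patterns
  destroyed by switches, where at most \<open>k\<close> switches and \<open>2 * k\<close> half-edges
  per pattern give \<open>2 * k ^ 2\<close>; and patterns sharing an edge.\<close>

definition error :: real where
  "error = (\<Sum>h\<in>H. (touching h)\<^sup>2) + 2 * (real k)\<^sup>2 * rate * (weight A)\<^sup>2
    + (\<Sum>a\<in>A. rate ^ card a * overlap a)"

text \<open>After exchanging the sums, \<open>h\<close> collects the weights of all patterns through
  it, which is \<open>touching h\<close> once more.\<close>

lemma sum_weight_touching:
  "(\<Sum>a\<in>A. rate ^ card a * (\<Sum>h\<in>\<Union>a. touching h)) = (\<Sum>h\<in>H. (touching h)\<^sup>2)"
proof -
  have "(\<Sum>a\<in>A. rate ^ card a * (\<Sum>h\<in>\<Union>a. touching h)) =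
      (\<Sum>a\<in>A. \<Sum>h\<in>H. if h \<in> \<Union>a then rate ^ card a * touching h else 0)"
  proof (rule sum.cong[OF refl])
    fix a assume a: "a \<in> A"
    then have "H \<inter> \<Union>a = \<Union>a" using edge by auto
    then show "rate ^ card a * (\<Sum>h\<in>\<Union>a. touching h) =
        (\<Sum>h\<in>H. if h \<in> \<Union>a then rate ^ card a * touching h else 0)"
      using finite_H by (simp add: sum.inter_restrict[symmetric] sum_distrib_left del: Union_iff)
  qed
  also have "\<dots> = (\<Sum>h\<in>H. \<Sum>a\<in>A. if h \<in> \<Union>a then rate ^ card a * touching h else 0)"
    by (rule sum.swap)
  also have "\<dots> = (\<Sum>h\<in>H. (touching h)\<^sup>2)"
  proof (rule sum.cong[OF refl])
    fix h
    have "(\<Sum>a\<in>A. if h \<in> \<Union>a then rate ^ card a * touching h else 0) =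
        (\<Sum>a | a \<in> A \<and> h \<in> \<Union>a. rate ^ card a * touching h)"
      using finite_A by (simp add: sum.inter_filter del: Union_iff)
    then show "(\<Sum>a\<in>A. if h \<in> \<Union>a then rate ^ card a * touching h else 0) = (touching h)\<^sup>2"
      by (simp add: power2_eq_square sum_distrib_right touching_def weight_def)
  qed
  finally show ?thesis .
qed

text \<open>\<open>W * x ^ (W - 1)\<close> splits into one term for each occurring pattern.
  Conditioning on that pattern and then ignoring it leaves \<open>E (x ^ W)\<close> up to the three
  parts of \<open>error\<close>. For \<open>W = 0\<close> the truncated exponent is harmless, since
  the factor \<open>W\<close> vanishes.\<close>

lemma derivative_bound:
  fixes x :: real
  assumes x: "0 \<le> x" "x \<le> 1"
  shows "\<bar>pairing_avg H (\<lambda>P. real (pattern_count A P) * x ^ (pattern_count A P - 1))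
      - mean * pairing_avg H (\<lambda>P. x ^ pattern_count A P)\<bar> \<le> error"
proof -
  let ?W = "pattern_count A"
  let ?p = "\<lambda>a. pairing_avg H (\<lambda>P. of_bool (a \<subseteq> P))"
  let ?g = "pairing_avg H (\<lambda>P. x ^ ?W P)"
  let ?ga = "\<lambda>a. pairing_avg (H - \<Union>a) (\<lambda>Q. x ^ (?W (a \<union> Q) - 1))"
  have "pairing_avg H (\<lambda>P. real (?W P) * x ^ (?W P - 1)) =
      (\<Sum>a\<in>A. pairing_avg H (\<lambda>P. of_bool (a \<subseteq> P) * x ^ (?W P - 1)))"
    unfolding pattern_count_sum[OF finite_A] sum_distrib_right pairing_avg_sum ..
  also have "\<dots> = (\<Sum>a\<in>A. ?p a * ?ga a)"
    using pattern edge finite_H even_H by (intro sum.cong refl pairing_avg_containing) auto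
  finally have 1: "pairing_avg H (\<lambda>P. real (?W P) * x ^ (?W P - 1)) = (\<Sum>a\<in>A. ?p a * ?ga a)" .
  have 2: "mean * ?g = (\<Sum>a\<in>A. ?p a * ?g)"
    unfolding mean_def pattern_count_sum[OF finite_A] sum_distrib_right pairing_avg_sum ..
  have "\<bar>pairing_avg H (\<lambda>P. real (?W P) * x ^ (?W P - 1)) - mean * ?g\<bar> = \<bar>\<Sum>a\<in>A. ?p a * (?ga a - ?g)\<bar>"
    unfolding 1 2 by (simp add: algebra_simps sum_subtractf)
  also have "\<dots> \<le> (\<Sum>a\<in>A. \<bar>?p a * (?ga a - ?g)\<bar>)" by (rule sum_abs)
  also have "\<dots> \<le> (\<Sum>a\<in>A. rate ^ card a *
      ((\<Sum>h\<in>\<Union>a. touching h) + real k * (2 * real k * rate * weight A) + overlap a))"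
  proof (rule sum_mono)
    fix a assume a: "a \<in> A"
    have "?p a \<le> rate ^ card a" "0 \<le> ?p a"
      using pattern[OF a] even_H by (auto intro!: avg_contains_le pairing_avg_nonneg)
    moreover have "\<bar>?ga a - ?g\<bar> \<le> (\<Sum>h\<in>\<Union>a. touching h) + real k * (2 * real k * rate * weight A) + overlap a"
    proof -
      have "\<bar>?g - pairing_avg (H - \<Union>a) (\<lambda>P. x ^ ?W P)\<bar>
          \<le> (\<Sum>h\<in>\<Union>a. touching h) + real (card a) * (2 * real k * rate * weight A)"
        using pattern[OF a] edge[OF a] even_H x by (intro avg_power_remove_edges) auto
      moreover have "real (card a) * (2 * real k * rate * weight A) \<le> real k * (2 * real k * rate * weight A)"
        using pattern[OF a] rate_pos weight_nonneg by (intro mult_right_mono) auto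
      ultimately show ?thesis using avg_power_shift[OF x a] by linarith
    qed
    ultimately show "\<bar>?p a * (?ga a - ?g)\<bar> \<le> rate ^ card a *
      ((\<Sum>h\<in>\<Union>a. touching h) + real k * (2 * real k * rate * weight A) + overlap a)"
      by (simp add: abs_mult mult_mono)
  qed
  also have "\<dots> = error"
  proof -
    have "(\<Sum>a\<in>A. rate ^ card a * (real k * (2 * real k * rate * weight A))) =
        2 * (real k)\<^sup>2 * rate * (weight A)\<^sup>2"
      by (simp add: sum_distrib_right[symmetric] weight_def[symmetric] power2_eq_square)
    then show ?thesis
      unfolding error_def by (simp only: distrib_left sum.distrib sum_weight_touching)
  qed
  finally show ?thesis .
qed

lemma mean_nonneg: "mean \<ge> 0"
  by (simp add: mean_def pairing_avg_nonneg)

text \<open>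
  With \<open>g x = E (x ^ W)\<close>, the function \<open>x \<mapsto> exp (- mean * x) * g x\<close> has derivative at most \<open>error\<close>
  on the unit interval; its values at the endpoints are \<open>P (W = 0)\<close> and \<open>exp (- mean)\<close>.
\<close>

theorem avg_no_pattern:
  "\<bar>pairing_avg H (\<lambda>P. of_bool (pattern_count A P = 0)) - exp (- mean)\<bar> \<le> error"
proof -
  let ?W = "pattern_count A"
  define g where "g x = pairing_avg H (\<lambda>P. x ^ ?W P)" for x :: real
  define g' where "g' x = pairing_avg H (\<lambda>P. real (?W P) * x ^ (?W P - 1))" for x :: real
  have g: "(g has_real_derivative g' x) (at x)" for x
    unfolding g_def[abs_def] g'_def pairing_avg_def
    using card_pairings_pos[OF finite_H even_H]
    by (auto intro!: derivative_eq_intros)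
  define \<phi> where "\<phi> x = exp (- mean * x) * g x" for x
  have \<phi>: "(\<phi> has_real_derivative exp (- mean * x) * (g' x - mean * g x)) (at x)" for x
    unfolding \<phi>_def[abs_def] by (auto intro!: derivative_eq_intros g simp: algebra_simps)
  obtain z where z: "0 < z" "z < 1" "\<phi> 1 - \<phi> 0 = (1 - 0) * (exp (- mean * z) * (g' z - mean * g z))"
    using MVT2[of 0 1 \<phi> "\<lambda>x. exp (- mean * x) * (g' x - mean * g x)"] \<phi> by auto
  have "g 1 = 1" unfolding g_def using finite_H even_H by (simp add: pairing_avg_const)
  moreover have "g 0 = pairing_avg H (\<lambda>P. of_bool (?W P = 0))"
    unfolding g_def by (simp add: power_0_left of_bool_def)
  ultimately have "\<bar>pairing_avg H (\<lambda>P. of_bool (?W P = 0)) - exp (- mean)\<bar> = \<bar>\<phi> 1 - \<phi> 0\<bar>"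
    by (simp add: \<phi>_def)
  also have "\<dots> = exp (- mean * z) * \<bar>g' z - mean * g z\<bar>"
    using z by (simp add: abs_mult)
  also have "\<dots> \<le> 1 * error"
    using z mean_nonneg derivative_bound[of z] unfolding g_def g'_def
    by (intro mult_mono) auto
  finally show ?thesis by simp
qed

end

section \<open>Loops and double edges as patterns\<close>

text \<open>\<open>fst\<close> sends a half-edge to its vertex, so an edge is a loop iff its image
  is a singleton. The loop is wrapped in a one-edge set so as to be a pattern.\<close>

definition loop_patterns :: "(nat \<times> nat) set \<Rightarrow> (nat \<times> nat) set set set" where
  "loop_patterns H = (\<lambda>e. {e}) ` {e. e \<subseteq> H \<and> card e = 2 \<and> card (fst ` e) = 1}"

definition double_patterns :: "(nat \<times> nat) set \<Rightarrow> (nat \<times> nat) set set set" where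
  "double_patterns H = {a. card a = 2 \<and> disjoint a \<and>
     (\<forall>e\<in>a. e \<subseteq> H \<and> card e = 2 \<and> card (fst ` e) = 2) \<and> (\<forall>e\<in>a. \<forall>f\<in>a. fst ` e = fst ` f)}"

lemma card_2_ordered: "card (v :: nat set) = 2 \<Longrightarrow> \<exists>i j. v = {i, j} \<and> i < j"
proof -
  assume "card v = 2"
  then obtain i j where ij: "v = {i, j}" "i \<noteq> j" by (meson card_2_iff)
  then show ?thesis
  proof (cases "i < j")
    case False
    then have "v = {j, i}" "j < i" using ij by auto
    then show ?thesis by blast
  qed (use ij in blast)
qed

lemma double_patternsD:
  assumes "a \<in> double_patterns H"
  shows "card a = 2" "disjoint a" "e \<in> a \<Longrightarrow> e \<subseteq> H" "e \<in> a \<Longrightarrow> card e = 2"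
    "e \<in> a \<Longrightarrow> card (fst ` e) = 2" "e \<in> a \<Longrightarrow> f \<in> a \<Longrightarrow> fst ` e = fst ` f"
  using assms unfolding double_patterns_def by blast+

lemma finite_patterns:
  assumes "finite H"
  shows "finite (loop_patterns H)" "finite (double_patterns H)"
proof -
  show "finite (loop_patterns H)"
    using assms by (simp add: loop_patterns_def)
  show "finite (double_patterns H)"
    by (rule finite_subset[of _ "Pow (Pow H)"]) (use assms in \<open>auto simp: double_patterns_def\<close>)
qed

lemma patterns_Int: "loop_patterns H \<inter> double_patterns H = {}"
proof -
  have "card a = 1" if "a \<in> loop_patterns H" for a using that by (auto simp: loop_patterns_def)
  moreover have "card a = 2" if "a \<in> double_patterns H" for a using that by (rule double_patternsD)
  ultimately show ?thesis by (metis Int_emptyI numeral_eq_one_iff semiring_norm(85))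
qed

lemma count_multigraph_of_pairing:
  assumes "finite P"
  shows "count (multigraph_of_pairing P) v = card {e \<in> P. fst ` e = v}"
proof -
  have "(\<lambda>e. fst ` e) -` {v} \<inter> P = {e \<in> P. fst ` e = v}" by auto
  then show ?thesis
    using assms by (simp add: multigraph_of_pairing_def count_image_mset)
qed

lemma finite_half_edges: "finite (half_edges n d)"
  by (simp add: half_edges_def)

context
  fixes n :: nat and d :: "nat \<Rightarrow> nat" and P :: "(nat \<times> nat) set set"
  assumes P: "P \<in> pairings (half_edges n d)"
begin

private lemma finP: "finite P"
  using finite_pairing[OF finite_half_edges P] .

private lemma edge_in: "e \<in> P \<Longrightarrow> e \<subseteq> half_edges n d \<and> card e = 2 \<and> finite e"
  using P card_ge_0_finite[of e] by (auto simp: pairings_iff)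

private lemma fst_edge: "e \<in> P \<Longrightarrow> fst ` e \<subseteq> {1..n}"
  using edge_in[of e] by (auto simp: half_edges_def)

private lemma card_fst_edge: "e \<in> P \<Longrightarrow> card (fst ` e) = 1 \<or> card (fst ` e) = 2"
proof -
  assume "e \<in> P"
  then have "card e = 2" "finite e" using edge_in by auto
  moreover have "card (fst ` e) \<le> card e" using calculation by (intro card_image_le)
  moreover have "card (fst ` e) \<noteq> 0" using calculation by auto
  ultimately show ?thesis by linarith
qed

lemma self_loops_eq_pattern_count:
  "self_loops n (multigraph_of_pairing P) = pattern_count (loop_patterns (half_edges n d)) P"
proof -
  have "self_loops n (multigraph_of_pairing P) = (\<Sum>i\<in>{1..n}. card {e \<in> P. fst ` e = {i}})"
    using finP by (simp add: self_loops_def edge_count_def count_multigraph_of_pairing)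
  also have "\<dots> = card (\<Union>i\<in>{1..n}. {e \<in> P. fst ` e = {i}})"
    using finP by (intro card_UN_disjoint[symmetric]) auto
  also have "(\<Union>i\<in>{1..n}. {e \<in> P. fst ` e = {i}}) = {e \<in> P. card (fst ` e) = 1}"
  proof (intro equalityI subsetI)
    fix e assume e: "e \<in> {e \<in> P. card (fst ` e) = 1}"
    then obtain i where "fst ` e = {i}" by (auto simp: card_1_singleton_iff)
    moreover have "fst ` e \<subseteq> {1..n}" using e fst_edge by blast
    ultimately show "e \<in> (\<Union>i\<in>{1..n}. {e \<in> P. fst ` e = {i}})" using e by auto
  qed auto
  also have "card \<dots> = card ((\<lambda>e. {e}) ` {e \<in> P. card (fst ` e) = 1})"
    by (simp add: card_image)
  also have "(\<lambda>e. {e}) ` {e \<in> P. card (fst ` e) = 1} = {b \<in> loop_patterns (half_edges n d). b \<subseteq> P}"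
    using edge_in by (auto simp: loop_patterns_def)
  finally show ?thesis by (simp add: pattern_count_def)
qed

text \<open>\<open>m choose 2\<close> counts the two-element sets of edges with ends
  \<open>i\<close> and \<open>j\<close>. The families of these sets are disjoint for different pairs
  \<open>i < j\<close>, because any edge in such a set reveals its ends.\<close>

lemma multi_edges_eq_pattern_count:
  "multi_edges n (multigraph_of_pairing P) = pattern_count (double_patterns (half_edges n d)) P"
proof -
  let ?I = "SIGMA i:{1..n}. {i+1..n}"
  let ?E = "\<lambda>i j. {e \<in> P. fst ` e = {i, j}}"
  have "multi_edges n (multigraph_of_pairing P) = (\<Sum>(i, j)\<in>?I. card (?E i j) choose 2)"
    using finP by (simp add: multi_edges_def edge_count_def count_multigraph_of_pairing sum.Sigma)
  also have "\<dots> = (\<Sum>(i, j)\<in>?I. card {a. a \<subseteq> ?E i j \<and> card a = 2})"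
    using finP by (simp add: n_subsets)
  also have "\<dots> = (\<Sum>p\<in>?I. card {a. a \<subseteq> ?E (fst p) (snd p) \<and> card a = 2})"
    by (simp add: case_prod_beta)
  also have "\<dots> = card (\<Union>p\<in>?I. {a. a \<subseteq> ?E (fst p) (snd p) \<and> card a = 2})"
  proof (rule card_UN_disjoint[symmetric])
    have "p = q" if "p \<in> ?I" "q \<in> ?I" "a \<subseteq> ?E (fst p) (snd p)" "a \<subseteq> ?E (fst q) (snd q)" "card a = 2" for p q a
    proof -
      obtain e where "e \<in> a" using \<open>card a = 2\<close> by fastforce
      then have "fst ` e = {fst p, snd p}" "fst ` e = {fst q, snd q}" using that(3,4) by auto
      then have "{fst p, snd p} = {fst q, snd q}" by simp
      then show "p = q" using that(1,2) by (auto simp: doubleton_eq_iff prod_eq_iff)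
    qed
    then show "\<forall>p\<in>?I. \<forall>q\<in>?I. p \<noteq> q \<longrightarrow> {a. a \<subseteq> ?E (fst p) (snd p) \<and> card a = 2} \<inter>
        {a. a \<subseteq> ?E (fst q) (snd q) \<and> card a = 2} = {}" by blast
    show "\<forall>p\<in>?I. finite {a. a \<subseteq> ?E (fst p) (snd p) \<and> card a = 2}"
      using finP by simp
  qed simp
  also have "(\<Union>p\<in>?I. {a. a \<subseteq> ?E (fst p) (snd p) \<and> card a = 2}) =
      {b \<in> double_patterns (half_edges n d). b \<subseteq> P}" (is "?L = ?R")
  proof
    show "?L \<subseteq> ?R"
    proof
      fix a assume "a \<in> ?L"
      then obtain p where p: "p \<in> ?I" "a \<subseteq> ?E (fst p) (snd p)" "card a = 2" by blast
      moreover have "fst p < snd p" using p(1) by (cases p) simp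
      ultimately obtain i j where ij: "i < j" and a: "a \<subseteq> ?E i j" "card a = 2"
        by blast
      moreover have "disjoint a"
        using P a(1) by (auto simp: pairings_iff intro: pairwise_subset)
      moreover have f: "fst ` e = {i, j}" if "e \<in> a" for e using a(1) that by auto
      then have "card (fst ` e) = 2" "fst ` e = fst ` f" if "e \<in> a" "f \<in> a" for e f
        using ij that by simp_all
      moreover have "e \<in> P" if "e \<in> a" for e using a(1) that by auto
      ultimately show "a \<in> ?R"
        unfolding double_patterns_def mem_Collect_eq using edge_in a(2) by blast
    qed
    show "?R \<subseteq> ?L"
    proof
      fix a assume a: "a \<in> ?R"
      then have "card a = 2" using double_patternsD(1) by blast
      then obtain e where e: "e \<in> a" by fastforce
      then have "card (fst ` e) = 2" using a double_patternsD(5) by blast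
      then obtain i j where ij: "fst ` e = {i, j}" "i < j"
        using card_2_ordered by blast
      have "e \<in> P" using a e by blast
      then have "(i, j) \<in> ?I" using fst_edge[of e] ij by auto
      moreover have "fst ` f = fst ` e" if "f \<in> a" for f
        using a e that double_patternsD(6) by blast
      then have "a \<subseteq> ?E i j" using a ij(1) by auto
      ultimately show "a \<in> ?L" using \<open>card a = 2\<close> by (intro UN_I[of "(i, j)"]) simp_all
    qed
  qed
  finally show ?thesis by (simp add: pattern_count_def)
qed

text \<open>\<open>simple_multigraph\<close> quantifies over all vertices and all sets, the two
  counts only over \<open>1..n\<close> and pairs \<open>i < j\<close>. They agree because an edge of
  \<open>P\<close> projects to one or two vertices in \<open>1..n\<close>, and a repeated loop is
  already excluded as a loop.\<close>

lemma simple_iff_pattern_count: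
  "simple_multigraph (multigraph_of_pairing P) \<longleftrightarrow>
    self_loops n (multigraph_of_pairing P) = 0 \<and> multi_edges n (multigraph_of_pairing P) = 0"
proof -
  let ?G = "multigraph_of_pairing P"
  have set: "v \<in># ?G \<longleftrightarrow> (\<exists>e\<in>P. v = fst ` e)" for v
    using finP by (auto simp: multigraph_of_pairing_def)
  show ?thesis
  proof
    assume s: "simple_multigraph ?G"
    then have "count ?G {i, i} = 0" for i
      by (simp add: simple_multigraph_def count_eq_zero_iff)
    moreover have "count ?G v choose 2 = 0" for v
    proof -
      have "count ?G v \<le> 1" using s by (simp add: simple_multigraph_def)
      then show ?thesis by (intro binomial_eq_0) simp
    qed
    ultimately show "self_loops n ?G = 0 \<and> multi_edges n ?G = 0"
      by (simp add: self_loops_def multi_edges_def edge_count_def)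
  next
    assume z: "self_loops n ?G = 0 \<and> multi_edges n ?G = 0"
    have loop: "{i} \<notin># ?G" for i
    proof
      assume i: "{i} \<in># ?G"
      then have "i \<in> {1..n}" using set fst_edge by blast
      then have "count ?G {i, i} = 0"
        using z unfolding self_loops_def edge_count_def by (meson finite_atLeastAtMost sum_eq_0_iff)
      then show False using i by (simp add: count_eq_zero_iff)
    qed
    moreover have "count ?G v \<le> 1" for v
    proof (cases "v \<in># ?G")
      case True
      then obtain e where e: "e \<in> P" "v = fst ` e" using set by auto
      have "card v \<noteq> 1" using loop True by (auto simp: card_1_singleton_iff)
      then have "card v = 2" using card_fst_edge e by auto
      then obtain i j where ij: "v = {i, j}" "i < j"
        using card_2_ordered by blast
      then have I: "i \<in> {1..n}" "j \<in> {i+1..n}" using fst_edge[of e] e by auto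
      have "(\<Sum>j=i+1..n. edge_count ?G i j choose 2) = 0"
        using z I(1) unfolding multi_edges_def by (meson finite_atLeastAtMost sum_eq_0_iff)
      then have "edge_count ?G i j choose 2 = 0"
        using I(2) by (meson finite_atLeastAtMost sum_eq_0_iff)
      then show ?thesis using ij by (simp add: edge_count_def)
    qed (simp add: count_eq_zero_iff[THEN iffD2])
    ultimately show "simple_multigraph ?G" by (simp add: simple_multigraph_def)
  qed
qed

end

lemma card_half_edges: "card (half_edges n d) = (\<Sum>i=1..n. d i)"
  by (simp add: half_edges_def)

definition degree_power_sum :: "nat \<Rightarrow> nat \<Rightarrow> (nat \<Rightarrow> nat) \<Rightarrow> nat" where
  "degree_power_sum k n d = (\<Sum>i=1..n. d i ^ k)"

section \<open>The configuration model as an average over pairings\<close>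

locale degree_sequence =
  fixes n :: nat and d :: "nat \<Rightarrow> nat"
begin

abbreviation "H \<equiv> half_edges n d"
abbreviation "S m \<equiv> degree_power_sum m n d"

end

locale even_degree_sequence = degree_sequence +
  assumes even_sum: "even (\<Sum>i=1..n. d i)"
begin

lemma pairings_half_edges: "finite (pairings H)" "pairings H \<noteq> {}"
  using card_pairings_pos[of H] finite_pairings[of H] even_sum
  by (auto simp: card_half_edges finite_half_edges)

lemma expectation_configuration_model:
  "measure_pmf.expectation (configuration_model n d) f = pairing_avg H (\<lambda>P. f (multigraph_of_pairing P))"
  using pairings_half_edges
  by (simp add: configuration_model_def integral_map_pmf integral_pmf_of_set pairing_avg_def)

lemma prob_configuration_model:
  "measure_pmf.prob (configuration_model n d) {G. Q G} =
    pairing_avg H (\<lambda>P. of_bool (Q (multigraph_of_pairing P)))"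
proof -
  have "measure_pmf.prob (configuration_model n d) {G. Q G} =
      measure_pmf.expectation (configuration_model n d) (indicator {G. Q G})"
    by simp
  then show ?thesis
    unfolding expectation_configuration_model by (simp add: indicator_def)
qed

lemma lambda_S_eq: "lambda_S n d = pairing_avg H (\<lambda>P. real (pattern_count (loop_patterns H) P))"
  unfolding lambda_S_def expectation_configuration_model
  by (intro pairing_avg_cong) (simp add: self_loops_eq_pattern_count)

lemma lambda_M_eq: "lambda_M n d = pairing_avg H (\<lambda>P. real (pattern_count (double_patterns H) P))"
  unfolding lambda_M_def expectation_configuration_model
  by (intro pairing_avg_cong) (simp add: multi_edges_eq_pattern_count)

text \<open>Additivity turns \<open>S_n + M_n\<close> into the count of a single family, so that
  \<open>S_n = M_n = 0\<close> is again the event that no pattern occurs.\<close>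

lemma pattern_count_Un:
  "pattern_count (loop_patterns H \<union> double_patterns H) P =
    pattern_count (loop_patterns H) P + pattern_count (double_patterns H) P"
proof -
  have "{b \<in> loop_patterns H \<union> double_patterns H. b \<subseteq> P} =
    {b \<in> loop_patterns H. b \<subseteq> P} \<union> {b \<in> double_patterns H. b \<subseteq> P}" by auto
  then show ?thesis
    using patterns_Int[of H] finite_patterns[OF finite_half_edges[of n d]]
    by (simp add: pattern_count_def, intro card_Un_disjoint) auto
qed

lemma lambda_S_plus_lambda_M:
  "lambda_S n d + lambda_M n d =
    pairing_avg H (\<lambda>P. real (pattern_count (loop_patterns H \<union> double_patterns H) P))"
  by (simp add: lambda_S_eq lambda_M_eq pattern_count_Un pairing_avg_add)

lemma prob_no_loops_eq:
  "prob_no_loops n d = pairing_avg H (\<lambda>P. of_bool (pattern_count (loop_patterns H) P = 0))"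
  unfolding prob_no_loops_def prob_configuration_model
  by (intro pairing_avg_cong) (simp add: self_loops_eq_pattern_count)

lemma prob_no_multi_edges_eq:
  "prob_no_multi_edges n d = pairing_avg H (\<lambda>P. of_bool (pattern_count (double_patterns H) P = 0))"
  unfolding prob_no_multi_edges_def prob_configuration_model
  by (intro pairing_avg_cong) (simp add: multi_edges_eq_pattern_count)

lemma prob_neither_eq:
  "prob_neither n d =
    pairing_avg H (\<lambda>P. of_bool (pattern_count (loop_patterns H \<union> double_patterns H) P = 0))"
  unfolding prob_neither_def prob_configuration_model
  by (intro pairing_avg_cong)
    (simp add: self_loops_eq_pattern_count multi_edges_eq_pattern_count pattern_count_Un)

lemma prob_simple_eq_neither: "prob_simple n d = prob_neither n d"
  unfolding prob_simple_def prob_neither_def prob_configuration_model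
  by (intro pairing_avg_cong) (simp add: simple_iff_pattern_count)

end

section \<open>Counting patterns\<close>

lemma card_2_member: "card e = 2 \<Longrightarrow> \<exists>s. s \<in> e"
  by (metis card.empty ex_in_conv zero_neq_numeral)

text \<open>Normal form seen from a chosen half-edge \<open>s\<close>: \<open>s\<close> and
  \<open>s'\<close> lie at one vertex, \<open>t\<close> and \<open>t'\<close> at the other. The
  counts of double edges below are parametrised by it.\<close>

lemma double_patterns_cases:
  assumes a: "a \<in> double_patterns H" and e: "e \<in> a" and s: "s \<in> e"
  obtains t s' t' where "a = {{s, t}, {s', t'}}" "e = {s, t}" "{s, t, s', t'} \<subseteq> H"
    "fst s' = fst s" "fst t' = fst t" "fst s \<noteq> fst t" "s \<noteq> s'" "t \<noteq> t'"
proof -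
  have a': "card a = 2" "disjoint a" "\<And>e. e \<in> a \<Longrightarrow> e \<subseteq> H \<and> card e = 2 \<and> card (fst ` e) = 2"
    "\<And>e f. e \<in> a \<Longrightarrow> f \<in> a \<Longrightarrow> fst ` e = fst ` f"
    using double_patternsD[OF a] by blast+
  obtain f where f: "a = {e, f}" "e \<noteq> f"
    using a'(1) e by (metis card_2_iff doubleton_eq_iff insertE singletonD)
  obtain t where t: "e = {s, t}" "s \<noteq> t"
    using a'(3)[OF e] s by (metis card_2_iff doubleton_eq_iff insertE singletonD)
  have "card (fst ` {s, t}) = 2" using a'(3)[OF e] t by simp
  then have st: "fst s \<noteq> fst t" by (auto simp: card_insert_if split: if_splits)
  have fe: "fst ` f = {fst s, fst t}" using a'(4)[of f e] f t by simp
  then obtain s' t' where s't': "s' \<in> f" "t' \<in> f" "fst s' = fst s" "fst t' = fst t"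
    by (metis imageE insertI1 insertI2)
  then have ne: "s' \<noteq> t'" using st by metis
  have "card f = 2" using a'(3)[of f] f by simp
  then have feq: "f = {s', t'}" using s't' ne
    by (metis card_2_iff doubleton_eq_iff insertE singletonD)
  have "e \<inter> f = {}" using a'(2) f by (simp add: disjoint_def)
  then have "s \<noteq> s'" "t \<noteq> t'" using t feq by auto
  moreover have "{s, t, s', t'} \<subseteq> H" using a'(3) f t feq by auto
  ultimately show thesis
    by (intro that[of t s' t']) (simp_all only: f(1) t(1) feq s't' st not_False_eq_True)
qed

lemma double_patternsI:
  assumes "{s, t, s', t'} \<subseteq> H" "fst s' = fst s" "fst t' = fst t" "fst s \<noteq> fst t" "s \<noteq> s'" "t \<noteq> t'"
  shows "{{s, t}, {s', t'}} \<in> double_patterns H"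
proof -
  have ne: "s \<noteq> t" "s \<noteq> t'" "s' \<noteq> t" "s' \<noteq> t'" using assms by metis+
  then have "{s, t} \<inter> {s', t'} = {}" using assms by auto
  moreover from this have "{s, t} \<noteq> {s', t'}" by auto
  ultimately show ?thesis
    using assms ne by (auto simp: double_patterns_def disjoint_def)
qed

lemma loop_patterns_cases:
  assumes "a \<in> loop_patterns H" "s \<in> \<Union>a"
  obtains t where "a = {{s, t}}" "s \<in> H" "t \<in> H" "fst t = fst s" "s \<noteq> t"
proof -
  obtain e where e: "a = {e}" "e \<subseteq> H" "card e = 2" "card (fst ` e) = 1"
    using assms(1) by (auto simp: loop_patterns_def)
  then have "s \<in> e" using assms(2) by auto
  then obtain t where t: "e = {s, t}" "s \<noteq> t"
    using e by (metis card_2_iff doubleton_eq_iff insertE singletonD)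
  have "fst t = fst s"
    using e(4) unfolding t(1) by (auto simp: card_insert_if split: if_splits)
  then show thesis using that[of t] e t by auto
qed

lemma loop_patternsI: "s \<in> H \<Longrightarrow> t \<in> H \<Longrightarrow> fst t = fst s \<Longrightarrow> s \<noteq> t \<Longrightarrow> {{s, t}} \<in> loop_patterns H"
  by (auto simp: loop_patterns_def)

context degree_sequence
begin

definition fiber_pairs :: "((nat \<times> nat) \<times> (nat \<times> nat)) set" where
  "fiber_pairs = {(s, t). s \<in> H \<and> t \<in> H \<and> fst s = fst t}"

definition fiber_triples :: "((nat \<times> nat) \<times> (nat \<times> nat) \<times> (nat \<times> nat)) set" where
  "fiber_triples = {(s, t, u). s \<in> H \<and> t \<in> H \<and> u \<in> H \<and> fst s = fst t \<and> fst s = fst u}"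

lemma fiber: "s \<in> H \<Longrightarrow> card {t \<in> H. fst t = fst s} = d (fst s)" "finite {t \<in> H. fst t = fst s}"
proof -
  show "finite {t \<in> H. fst t = fst s}" using finite_half_edges by simp
  assume "s \<in> H"
  then have "{t \<in> H. fst t = fst s} = Pair (fst s) ` {..<d (fst s)}"
    by (auto simp: half_edges_def)
  then show "card {t \<in> H. fst t = fst s} = d (fst s)"
    by (simp add: card_image inj_on_def)
qed

text \<open>Size biasing: summing over half-edges weights each vertex by its degree, which raises a
  power sum by one order.\<close>

lemma sum_half_edges: "(\<Sum>h\<in>H. f (fst h)) = (\<Sum>i=1..n. of_nat (d i) * (f i :: 'b :: semiring_1))"
proof -
  have "(\<Sum>h\<in>H. f (fst h)) = (\<Sum>i=1..n. \<Sum>k<d i. f i)"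
    unfolding half_edges_def by (subst sum.Sigma) (simp_all add: case_prod_unfold)
  then show ?thesis by simp
qed

lemma finite_fibers: "finite fiber_pairs" "finite fiber_triples"
proof -
  show "finite fiber_pairs"
    by (rule finite_subset[of _ "H \<times> H"]) (auto simp: fiber_pairs_def finite_half_edges)
  show "finite fiber_triples"
    by (rule finite_subset[of _ "H \<times> H \<times> H"]) (auto simp: fiber_triples_def finite_half_edges)
qed

lemma card_fiber_pairs: "card fiber_pairs = S 2"
proof -
  have "fiber_pairs = (SIGMA s:H. {t \<in> H. fst t = fst s})" by (auto simp: fiber_pairs_def)
  then have "card fiber_pairs = (\<Sum>s\<in>H. card {t \<in> H. fst t = fst s})"
    using finite_half_edges by simp
  also have "\<dots> = (\<Sum>s\<in>H. d (fst s))" by (intro sum.cong refl fiber)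
  finally show ?thesis
    using sum_half_edges[of d] by (simp add: degree_power_sum_def power2_eq_square)
qed

lemma card_fiber_triples: "card fiber_triples = S 3"
proof -
  have "fiber_triples = (SIGMA s:H. {t \<in> H. fst t = fst s} \<times> {t \<in> H. fst t = fst s})"
    by (auto simp: fiber_triples_def)
  then have "card fiber_triples = (\<Sum>s\<in>H. card {t \<in> H. fst t = fst s} * card {t \<in> H. fst t = fst s})"
    using finite_half_edges by (simp add: card_cartesian_product)
  also have "\<dots> = (\<Sum>s\<in>H. d (fst s) * d (fst s))" by (intro sum.cong refl) (simp add: fiber)
  finally show ?thesis
    using sum_half_edges[of "\<lambda>i. d i * d i"]
    by (simp add: degree_power_sum_def power3_eq_cube mult.assoc)
qed

lemma card_loops_at_le:
  assumes "h \<in> H"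
  shows "card {b \<in> loop_patterns H. h \<in> \<Union>b} \<le> d (fst h)"
proof -
  have "{b \<in> loop_patterns H. h \<in> \<Union>b} \<subseteq> (\<lambda>t. {{h, t}}) ` {t \<in> H. fst t = fst h}"
    by (auto elim!: loop_patterns_cases[where s = h])
  then have "card {b \<in> loop_patterns H. h \<in> \<Union>b} \<le> card {t \<in> H. fst t = fst h}"
    using fiber(2) by (rule surj_card_le[rotated])
  then show ?thesis using fiber(1)[OF assms] by simp
qed

text \<open>There are at most \<open>d (fst h)\<close> choices for the second half-edge at the
  vertex of \<open>h\<close>, and the two half-edges at the other vertex form an ordered fiber
  pair.\<close>

lemma card_doubles_at_le:
  assumes "h \<in> H"
  shows "card {b \<in> double_patterns H. h \<in> \<Union>b} \<le> d (fst h) * S 2"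
proof -
  have "{b \<in> double_patterns H. h \<in> \<Union>b} \<subseteq>
    (\<lambda>(h', (t, t')). {{h, t}, {h', t'}}) ` ({t \<in> H. fst t = fst h} \<times> fiber_pairs)"
  proof
    fix b assume "b \<in> {b \<in> double_patterns H. h \<in> \<Union>b}"
    then obtain e where "b \<in> double_patterns H" "e \<in> b" "h \<in> e" by auto
    then obtain t h' t' where "b = {{h, t}, {h', t'}}" "{h, t, h', t'} \<subseteq> H" "fst h' = fst h" "fst t' = fst t"
      by (rule double_patterns_cases)
    then show "b \<in> (\<lambda>(h', (t, t')). {{h, t}, {h', t'}}) ` ({t \<in> H. fst t = fst h} \<times> fiber_pairs)"
      by (intro image_eqI[of _ _ "(h', (t, t'))"]) (auto simp: fiber_pairs_def)
  qed
  then have "card {b \<in> double_patterns H. h \<in> \<Union>b} \<le> card ({t \<in> H. fst t = fst h} \<times> fiber_pairs)"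
    using fiber(2) finite_fibers by (intro surj_card_le) auto
  then show ?thesis using fiber(1)[OF assms] by (simp add: card_cartesian_product card_fiber_pairs)
qed

lemma card_loop_patterns_le: "card (loop_patterns H) \<le> S 2"
proof -
  have "loop_patterns H \<subseteq> (\<lambda>(s, t). {{s, t}}) ` fiber_pairs"
  proof
    fix b assume b: "b \<in> loop_patterns H"
    then obtain s where "s \<in> \<Union>b" using card_2_member by (fastforce simp: loop_patterns_def)
    with b obtain t where "b = {{s, t}}" "s \<in> H" "t \<in> H" "fst t = fst s"
      by (rule loop_patterns_cases)
    then show "b \<in> (\<lambda>(s, t). {{s, t}}) ` fiber_pairs"
      by (intro image_eqI[of _ _ "(s, t)"]) (auto simp: fiber_pairs_def)
  qed
  then show ?thesis
    using finite_fibers by (metis card_fiber_pairs surj_card_le)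
qed

lemma double_patterns_edge:
  assumes "b \<in> double_patterns H"
  obtains e s where "e \<in> b" "s \<in> e"
proof -
  have "card b = 2" using assms by (rule double_patternsD)
  then obtain e where e: "e \<in> b" using card_2_member by blast
  then have "card e = 2" using double_patternsD(4)[OF assms] by blast
  then obtain s where "s \<in> e" using card_2_member by blast
  with e show thesis by (rule that)
qed

lemma card_double_patterns_le: "card (double_patterns H) \<le> S 2 * S 2"
proof -
  have "double_patterns H \<subseteq> (\<lambda>((s, s'), (t, t')). {{s, t}, {s', t'}}) ` (fiber_pairs \<times> fiber_pairs)"
  proof
    fix b assume b: "b \<in> double_patterns H"
    then obtain e s where "e \<in> b" "s \<in> e" by (rule double_patterns_edge)
    with b obtain t s' t' where "b = {{s, t}, {s', t'}}" "{s, t, s', t'} \<subseteq> H" "fst s' = fst s" "fst t' = fst t"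
      by (rule double_patterns_cases)
    then show "b \<in> (\<lambda>((s, s'), (t, t')). {{s, t}, {s', t'}}) ` (fiber_pairs \<times> fiber_pairs)"
      by (intro image_eqI[of _ _ "((s, s'), (t, t'))"]) (auto simp: fiber_pairs_def)
  qed
  then have "card (double_patterns H) \<le> card (fiber_pairs \<times> fiber_pairs)"
    using finite_fibers by (intro surj_card_le) auto
  then show ?thesis by (simp add: card_cartesian_product card_fiber_pairs)
qed

definition overlapping_doubles :: "((nat \<times> nat) set set \<times> (nat \<times> nat) set set) set" where
  "overlapping_doubles =
    {(a, b). a \<in> double_patterns H \<and> b \<in> double_patterns H \<and> b \<noteq> a \<and> b \<inter> a \<noteq> {}}"

text \<open>The shared edge \<open>{s, t}\<close> fixes both vertices, and at each vertex three
  half-edges are involved: its end of the shared edge and its ends of the two remaining edges. Hence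
  the product of two cubic sums.\<close>

lemma card_overlapping_doubles_le: "card overlapping_doubles \<le> S 3 * S 3"
proof -
  let ?f = "\<lambda>((s, s', s''), (t, t', t'')). ({{s, t}, {s', t'}}, {{s, t}, {s'', t''}})"
  have "overlapping_doubles \<subseteq> ?f ` (fiber_triples \<times> fiber_triples)"
  proof
    fix p assume "p \<in> overlapping_doubles"
    then obtain a b e where p: "p = (a, b)" "a \<in> double_patterns H" "b \<in> double_patterns H" "e \<in> a" "e \<in> b"
      by (auto simp: overlapping_doubles_def)
    then have "card e = 2" using double_patternsD(4) by blast
    then obtain s where s: "s \<in> e" using card_2_member by blast
    obtain t s' t' where 1: "a = {{s, t}, {s', t'}}" "e = {s, t}" "{s, t, s', t'} \<subseteq> H"
        "fst s' = fst s" "fst t' = fst t" "fst s \<noteq> fst t"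
      using p(2,4) s by (rule double_patterns_cases)
    obtain u s'' t'' where 2: "b = {{s, u}, {s'', t''}}" "e = {s, u}" "{s, u, s'', t''} \<subseteq> H"
        "fst s'' = fst s" "fst t'' = fst u" "fst s \<noteq> fst u"
      using p(3,5) s by (rule double_patterns_cases)
    have "u = t" using 1(2) 2(2) by (auto simp: doubleton_eq_iff)
    then show "p \<in> ?f ` (fiber_triples \<times> fiber_triples)"
      using 1 2 p(1) by (intro image_eqI[of _ _ "((s, s', s''), (t, t', t''))"]) (auto simp: fiber_triples_def)
  qed
  then have "card overlapping_doubles \<le> card (fiber_triples \<times> fiber_triples)"
    using finite_fibers by (intro surj_card_le) auto
  then show ?thesis by (simp add: card_cartesian_product card_fiber_triples)
qed

end

section \<open>Error terms and expectations\<close>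

lemma card_eq_fibers:
  assumes "finite T" "\<And>t. t \<in> T \<Longrightarrow> f t \<in> A" "finite A" "\<And>a. a \<in> A \<Longrightarrow> card {t \<in> T. f t = a} = k"
  shows "card T = k * card A"
proof -
  have "(\<Sum>t\<in>T. 1) = (\<Sum>a\<in>A. \<Sum>t\<in>{t \<in> T. f t = a}. 1 :: nat)"
    using assms by (intro sum.group[symmetric]) auto
  then show ?thesis using assms by (simp add: mult.commute)
qed

lemma loop_pattern_card: "b \<in> loop_patterns H \<Longrightarrow> card b = 1"
  by (auto simp: loop_patterns_def)

text \<open>Patterns have at most two edges, hence \<open>k = 2\<close> and
  \<open>8 = 4 * 2\<close>. For the antichain condition, members of one family have equal size, a
  double edge is too large to lie in a loop, and a loop cannot lie in a double edge because the
  edges there have two distinct ends.\<close>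

lemma pairing_patterns_loops_doubles:
  assumes "finite H" "even (card H)" "8 \<le> card H" and A: "A \<subseteq> loop_patterns H \<union> double_patterns H"
  shows "pairing_patterns H A 2"
proof
  show "finite A" using A finite_patterns[OF assms(1)] by (meson finite_Un finite_subset)
  fix a assume a: "a \<in> A"
  have "(card a = 1 \<or> card a = 2) \<and> disjoint a"
  proof (cases "a \<in> loop_patterns H")
    case True
    then show ?thesis by (auto simp: loop_patterns_def)
  next
    case False
    then have "a \<in> double_patterns H" using a A by blast
    then show ?thesis using double_patternsD(1,2) by blast
  qed
  moreover from this have "finite a" using card_ge_0_finite[of a] by auto
  ultimately have "finite a" "card a = 1 \<or> card a = 2" "disjoint a" by blast+
  then show "finite a \<and> a \<noteq> {} \<and> card a \<le> 2 \<and> disjoint a" by auto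
  show "card e = 2 \<and> e \<subseteq> H" if "e \<in> a" for e
  proof (cases "a \<in> loop_patterns H")
    case True
    then show ?thesis using that by (auto simp: loop_patterns_def)
  next
    case False
    then have "a \<in> double_patterns H" using a A by auto
    then show ?thesis using that double_patternsD by blast
  qed
  fix b assume b: "b \<in> A" "b \<subseteq> a"
  consider "a \<in> double_patterns H" "b \<in> double_patterns H" | "a \<in> loop_patterns H" "b \<in> loop_patterns H"
    | "a \<in> loop_patterns H" "b \<in> double_patterns H" | "a \<in> double_patterns H" "b \<in> loop_patterns H"
    using a b A by blast
  then show "b = a"
  proof cases
    case 1
    then show ?thesis using b(2) \<open>finite a\<close> double_patternsD(1) card_subset_eq by metis
  next
    case 2
    then show ?thesis using b(2) \<open>finite a\<close> loop_pattern_card card_subset_eq by metis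
  next
    case 3
    then have "card b = 2" "card a = 1" using double_patternsD(1) loop_pattern_card by blast+
    then show ?thesis using card_mono[OF \<open>finite a\<close> b(2)] by simp
  next
    case 4
    then obtain e where "b = {e}" "card (fst ` e) = 1" by (auto simp: loop_patterns_def)
    moreover have "card (fst ` e) = 2" using 4(1) b(2) calculation(1) double_patternsD(5)[of a H e] by auto
    ultimately show ?thesis by simp
  qed
qed (use assms in auto)

context degree_sequence
begin

text \<open>For \<open>k = 2\<close>, \<open>rate\<close> is \<open>1 / (card H - 7)\<close> and
  \<open>2 * k ^ 2\<close> is 8. A loop weighs \<open>r\<close> and a double edge
  \<open>r ^ 2\<close>, so the pattern counts above bound each part of the error.\<close>

lemma error_half_edges_le:
  assumes even: "even (card H)" "8 \<le> card H" and A: "A \<subseteq> loop_patterns H \<union> double_patterns H"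
  defines "r \<equiv> 1 / (real (card H) - 7)"
  shows "pairing_patterns.error H A 2 \<le> r\<^sup>2 * S 3 * (1 + r * S 2)\<^sup>2 + 8 * r * (r * S 2 * (1 + r * S 2))\<^sup>2 + r ^ 3 * (real (S 3))\<^sup>2"
proof -
  interpret pairing_patterns H A 2
    using even A finite_half_edges by (intro pairing_patterns_loops_doubles)
  have r: "rate = r" by (simp add: rate_def r_def)
  have r0: "r \<ge> 0" using rate_pos r by simp
  have fin: "finite (loop_patterns H)" "finite (double_patterns H)"
    using finite_patterns finite_half_edges by blast+
  have weight_le: "weight B \<le> r * real (card X) + r\<^sup>2 * real (card Y)"
    if "B \<subseteq> X \<union> Y" "X \<subseteq> loop_patterns H" "Y \<subseteq> double_patterns H" for B X Y
  proof -
    have f: "finite X" "finite Y" using that fin finite_subset by blast+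
    have XY: "X \<inter> Y = {}" using that patterns_Int[of H] by blast
    have "weight B \<le> weight (X \<union> Y)" using f that by (intro weight_mono) auto
    also have "\<dots> = (\<Sum>b\<in>X. rate ^ card b) + (\<Sum>b\<in>Y. rate ^ card b)"
      unfolding weight_def by (rule sum.union_disjoint[OF f XY])
    also have "(\<Sum>b\<in>X. rate ^ card b) = (\<Sum>b\<in>X. r)"
    proof (rule sum.cong[OF refl])
      fix b assume "b \<in> X"
      then have "card b = 1" using that(2) loop_pattern_card by blast
      then show "rate ^ card b = r" by (simp add: r)
    qed
    also have "(\<Sum>b\<in>Y. rate ^ card b) = (\<Sum>b\<in>Y. r\<^sup>2)"
    proof (rule sum.cong[OF refl])
      fix b assume "b \<in> Y"
      then have "card b = 2" using that(3) double_patternsD(1) by blast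
      then show "rate ^ card b = r\<^sup>2" by (simp add: r)
    qed
    finally show ?thesis by (simp add: mult.commute)
  qed
  have touching: "touching h \<le> real (d (fst h)) * (r * (1 + r * S 2))" if "h \<in> H" for h
  proof -
    have "touching h \<le> r * real (card {b \<in> loop_patterns H. h \<in> \<Union>b}) + r\<^sup>2 * real (card {b \<in> double_patterns H. h \<in> \<Union>b})"
      unfolding touching_def using A by (intro weight_le) blast+
    also have "\<dots> \<le> r * real (d (fst h)) + r\<^sup>2 * real (d (fst h) * S 2)"
      using r0 card_loops_at_le[OF that] card_doubles_at_le[OF that]
      by (intro add_mono mult_left_mono of_nat_mono) auto
    finally show ?thesis by (simp add: algebra_simps power2_eq_square)
  qed
  have "(\<Sum>h\<in>H. (touching h)\<^sup>2) \<le> (\<Sum>h\<in>H. (real (d (fst h)) * (r * (1 + r * S 2)))\<^sup>2)"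
    using touching touching_nonneg by (intro sum_mono power_mono)
  also have "\<dots> = (\<Sum>h\<in>H. (real (d (fst h)))\<^sup>2) * (r * (1 + r * S 2))\<^sup>2"
    by (simp add: power_mult_distrib flip: sum_distrib_right)
  also have "(\<Sum>h\<in>H. (real (d (fst h)))\<^sup>2) = S 3"
    using sum_half_edges[of "\<lambda>i. (real (d i))\<^sup>2"]
    by (simp add: degree_power_sum_def power2_eq_square power3_eq_cube mult.assoc)
  finally have 1: "(\<Sum>h\<in>H. (touching h)\<^sup>2) \<le> r\<^sup>2 * S 3 * (1 + r * S 2)\<^sup>2"
    by (simp add: power_mult_distrib mult_ac)
  have "weight A \<le> r * real (card (loop_patterns H)) + r\<^sup>2 * real (card (double_patterns H))"
    using A by (intro weight_le) auto
  also have "\<dots> \<le> r * real (S 2) + r\<^sup>2 * real (S 2 * S 2)"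
    using r0 card_loop_patterns_le card_double_patterns_le
    by (intro add_mono mult_left_mono of_nat_mono) auto
  also have "\<dots> = r * S 2 * (1 + r * S 2)" by (simp add: algebra_simps power2_eq_square)
  finally have 2: "(weight A)\<^sup>2 \<le> (r * S 2 * (1 + r * S 2))\<^sup>2"
    using weight_nonneg by (intro power_mono)
  let ?B = "\<lambda>a. {b. b \<in> A \<and> b \<noteq> a \<and> b \<inter> a \<noteq> {}}"
  \<comment> \<open>Sharing an edge with a loop means containing it, which the antichain condition
    excludes, so only double edges overlap. Two distinct ones share exactly one edge, leaving three
    edges in all and the weight \<open>r ^ 3\<close>.\<close>
  have ov: "(a, b) \<in> overlapping_doubles \<and> rate ^ card a * rate ^ card (b - a) = r ^ 3"
    if "a \<in> A" "b \<in> ?B a" for a b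
  proof -
    have "a \<notin> loop_patterns H"
      using that antichain[of b a] by (auto simp: loop_patterns_def)
    moreover have "b \<notin> loop_patterns H"
      using that antichain[of a b] by (auto simp: loop_patterns_def)
    ultimately have D: "a \<in> double_patterns H" "b \<in> double_patterns H" using that A by auto
    then have c: "card a = 2" "card b = 2" by (auto intro: double_patternsD)
    have fb: "finite b" using pattern that by auto
    have "card (b - a) = card b - card (b \<inter> a)" using fb by (simp add: card_Diff_subset_Int)
    moreover have "card (b \<inter> a) \<noteq> 0" using that fb by simp
    moreover have "card (b - a) \<noteq> 0"
      using that fb antichain[of a b] by auto
    ultimately have "card (b - a) = 1" using c by linarith
    then have "rate ^ card a * rate ^ card (b - a) = r ^ 3"
      using c by (simp add: r power2_eq_square power3_eq_cube)
    then show ?thesis using D that by (auto simp: overlapping_doubles_def)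
  qed
  have finov: "finite (overlapping_doubles)"
    by (rule finite_subset[of _ "double_patterns H \<times> double_patterns H"])
      (auto simp: overlapping_doubles_def fin)
  have "(\<Sum>a\<in>A. rate ^ card a * overlap a) = (\<Sum>a\<in>A. \<Sum>b\<in>?B a. rate ^ card a * rate ^ card (b - a))"
    by (simp add: overlap_def sum_distrib_left)
  also have "\<dots> = (\<Sum>(a, b)\<in>Sigma A ?B. rate ^ card a * rate ^ card (b - a))"
    using finite_A by (intro sum.Sigma) auto
  also have "\<dots> = (\<Sum>(a, b)\<in>Sigma A ?B. r ^ 3)"
    using ov by (intro sum.cong refl) auto
  also have "\<dots> \<le> (\<Sum>p\<in>overlapping_doubles. r ^ 3)"
    unfolding case_prod_unfold using ov r0 finov by (intro sum_mono2) auto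
  also have "\<dots> = r ^ 3 * real (card (overlapping_doubles))" by simp
  also have "\<dots> \<le> r ^ 3 * real (S 3 * S 3)"
    using card_overlapping_doubles_le r0 by (intro mult_left_mono of_nat_mono) auto
  finally have 3: "(\<Sum>a\<in>A. rate ^ card a * overlap a) \<le> r ^ 3 * (real (S 3))\<^sup>2"
    by (simp add: power2_eq_square)
  have "2 * (real 2)\<^sup>2 * rate * (weight A)\<^sup>2 \<le> 8 * r * (r * S 2 * (1 + r * S 2))\<^sup>2"
    using mult_left_mono[OF 2, of "8 * r"] r0 by (simp add: r)
  then show ?thesis unfolding error_def using 1 3 by linarith
qed

section \<open>Exact means and counts\<close>

lemma pairing_avg_loops:
  assumes "even (card H)"
  shows "pairing_avg H (\<lambda>P. real (pattern_count (loop_patterns H) P)) =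
    real (card (loop_patterns H)) / real (card H - 1)"
proof -
  have f: "finite (loop_patterns H)" using finite_patterns finite_half_edges by blast
  have "pairing_avg H (\<lambda>P. of_bool (b \<subseteq> P)) = 1 / real (card H - 1)" if b: "b \<in> loop_patterns H" for b
  proof -
    obtain e where e: "b = {e}" "e \<subseteq> H" "card e = 2" using b unfolding loop_patterns_def by blast
    have "even (card (H - e))" using e assms finite_half_edges[of n d]
      by (simp add: card_Diff_subset finite_subset[of e H])
    then show ?thesis
      using pairing_avg_edge[OF finite_half_edges assms e(2,3), of "\<lambda>_. 1"] e finite_half_edges[of n d]
      by (simp add: pairing_avg_const)
  qed
  then show ?thesis by (simp only: pattern_count_sum[OF f] pairing_avg_sum) simp
qed

text \<open>Two disjoint edges, revealed in turn, contribute \<open>1 / (L - 1)\<close> and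
  \<open>1 / (L - 3)\<close> with \<open>L = card H\<close>. The value is exact, as needed for a
  comparison with \<open>nu\<close> up to order \<open>1 / n\<close>.\<close>

lemma pairing_avg_doubles:
  assumes "even (card H)"
  shows "pairing_avg H (\<lambda>P. real (pattern_count (double_patterns H) P)) =
    real (card (double_patterns H)) / (real (card H - 1) * real (card H - 3))"
proof -
  have f: "finite (double_patterns H)" using finite_patterns finite_half_edges by blast
  have "pairing_avg H (\<lambda>P. of_bool (b \<subseteq> P)) = 1 / (real (card H - 1) * real (card H - 3))"
    if b: "b \<in> double_patterns H" for b
  proof -
    obtain e g where eg: "b = {e, g}" "e \<noteq> g" using double_patternsD(1)[OF b] by (meson card_2_iff)
    then have "e \<in> b" "g \<in> b" by auto
    then have e: "e \<subseteq> H" "card e = 2" "g \<subseteq> H" "card g = 2" "e \<inter> g = {}"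
      using double_patternsD[OF b] disjointD[OF double_patternsD(2)[OF b]] eg(2) by blast+
    have fin: "finite (H - e)" using finite_half_edges by blast
    have "g \<subseteq> H - e" using e by auto
    have c1: "card (H - e) = card H - 2"
      using e finite_half_edges[of n d] by (simp add: card_Diff_subset finite_subset[of _ H])
    have "card (H - e - g) = card (H - e) - 2"
      using e \<open>g \<subseteq> H - e\<close> fin by (simp add: card_Diff_subset finite_subset[of _ "H - e"])
    with c1 have c: "card (H - e) = card H - 2" "card (H - e - g) = card H - 2 - 2" by simp_all
    have "pairing_avg H (\<lambda>P. of_bool (b \<subseteq> P)) = pairing_avg H (\<lambda>P. of_bool (e \<in> P) * of_bool (g \<in> P))"
      unfolding eg by (intro pairing_avg_cong) auto
    also have "\<dots> = pairing_avg (H - e) (\<lambda>P. of_bool (g \<in> insert e P)) / real (card H - 1)"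
      by (rule pairing_avg_edge[OF finite_half_edges assms e(1,2)])
    also have "pairing_avg (H - e) (\<lambda>P. of_bool (g \<in> insert e P)) = pairing_avg (H - e) (\<lambda>P. of_bool (g \<in> P) * 1)"
      using eg by (intro pairing_avg_cong) auto
    also have "\<dots> = pairing_avg (H - e - g) (\<lambda>_. 1) / real (card (H - e) - 1)"
      using c assms by (intro pairing_avg_edge fin \<open>g \<subseteq> H - e\<close> e) simp
    also have "pairing_avg (H - e - g) (\<lambda>_. 1) = 1"
      using fin c assms by (intro pairing_avg_const) auto
    finally show ?thesis using c by (simp add: mult.commute)
  qed
  then show ?thesis by (simp only: pattern_count_sum[OF f] pairing_avg_sum) simp
qed

text \<open>The exact counterpart of \<open>fiber_pairs\<close>: without the diagonal, its
  cardinality is the numerator of \<open>nu\<close>.\<close>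

definition distinct_fiber_pairs :: "((nat \<times> nat) \<times> (nat \<times> nat)) set" where
  "distinct_fiber_pairs = {(s, t). s \<in> H \<and> t \<in> H \<and> fst s = fst t \<and> s \<noteq> t}"

lemma finite_distinct_fiber_pairs: "finite distinct_fiber_pairs"
  by (rule finite_subset[of _ "H \<times> H"]) (auto simp: distinct_fiber_pairs_def finite_half_edges)

lemma card_distinct_fiber_pairs: "real (card distinct_fiber_pairs) = (\<Sum>i=1..n. real (d i) * (real (d i) - 1))"
proof -
  have "fiber_pairs = distinct_fiber_pairs \<union> (\<lambda>h. (h, h)) ` H"
    by (auto simp: fiber_pairs_def distinct_fiber_pairs_def)
  then have "card (fiber_pairs) = card distinct_fiber_pairs + card ((\<lambda>h. (h, h)) ` H)"
    by (simp, intro card_Un_disjoint finite_distinct_fiber_pairs)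
      (auto simp: distinct_fiber_pairs_def finite_half_edges)
  also have "card ((\<lambda>h. (h, h)) ` H) = (\<Sum>i=1..n. d i)"
    by (simp add: card_image inj_on_def card_half_edges)
  finally have "real (S 2) = real (card distinct_fiber_pairs) + (\<Sum>i=1..n. real (d i))"
    unfolding card_fiber_pairs by simp
  then show ?thesis
    by (simp add: degree_power_sum_def power2_eq_square right_diff_distrib sum_subtractf)
qed

lemma card_loop_patterns: "card distinct_fiber_pairs = 2 * card (loop_patterns H)"
proof (rule card_eq_fibers[where f = "\<lambda>(s, t). {{s, t}}"])
  show "finite distinct_fiber_pairs" by (rule finite_distinct_fiber_pairs)
  show "finite (loop_patterns H)" using finite_patterns finite_half_edges by blast
  show "(case p of (s, t) \<Rightarrow> {{s, t}}) \<in> loop_patterns H" if "p \<in> distinct_fiber_pairs" for p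
    using that by (auto simp: distinct_fiber_pairs_def intro!: loop_patternsI)
  fix a assume a: "a \<in> loop_patterns H"
  then obtain s where "s \<in> \<Union>a" using card_2_member by (fastforce simp: loop_patterns_def)
  with a obtain t where t: "a = {{s, t}}" "s \<in> H" "t \<in> H" "fst t = fst s" "s \<noteq> t"
    by (rule loop_patterns_cases)
  then have "{p \<in> distinct_fiber_pairs. (case p of (s, t) \<Rightarrow> {{s, t}}) = a} = {(s, t), (t, s)}"
    by (auto simp: distinct_fiber_pairs_def doubleton_eq_iff)
  then show "card {p \<in> distinct_fiber_pairs. (case p of (s, t) \<Rightarrow> {{s, t}}) = a} = 2"
    using t by simp
qed

text \<open>The square counts two ordered pairs of half-edges, each pair at a common vertex. If the
  two vertices differ, the pairs yield a double edge, four to one; if they agree, four half-edges at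
  one vertex are involved, which happens at most \<open>S 4\<close> times. This second part is the
  source of the fourth moment.\<close>

lemma card_double_patterns:
  "4 * card (double_patterns H) \<le> (card distinct_fiber_pairs)\<^sup>2"
  "(card distinct_fiber_pairs)\<^sup>2 \<le> 4 * card (double_patterns H) + S 4"
proof -
  let ?T = "distinct_fiber_pairs"
  let ?U = "{p \<in> ?T \<times> ?T. fst (fst (fst p)) \<noteq> fst (fst (snd p))}"
  let ?V = "{p \<in> ?T \<times> ?T. fst (fst (fst p)) = fst (fst (snd p))}"
  let ?f = "\<lambda>((s, s'), (t, t')). {{s, t}, {s', t'}}"
  have finT: "finite (?T \<times> ?T)" using finite_distinct_fiber_pairs by simp
  have U: "card ?U = 4 * card (double_patterns H)"
  proof (rule card_eq_fibers[where f = ?f])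
    show "finite ?U" using finT by simp
    show "finite (double_patterns H)" using finite_patterns finite_half_edges by blast
    show "?f p \<in> double_patterns H" if "p \<in> ?U" for p
      using that by (auto simp: distinct_fiber_pairs_def intro!: double_patternsI)
    fix a assume a: "a \<in> double_patterns H"
    then obtain e s where "e \<in> a" "s \<in> e" by (rule double_patterns_edge)
    with a obtain t s' t' where t: "a = {{s, t}, {s', t'}}" "{s, t, s', t'} \<subseteq> H"
      "fst s' = fst s" "fst t' = fst t" "fst s \<noteq> fst t" "s \<noteq> s'" "t \<noteq> t'"
      by (rule double_patterns_cases)
    \<comment> \<open>The four preimages come from exchanging the two edges and exchanging the two
      vertices.\<close>
    have "{p \<in> ?U. ?f p = a} = {((s, s'), (t, t')), ((s', s), (t', t)), ((t, t'), (s, s')), ((t', t), (s', s))}"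
      (is "?L = ?R")
    proof
      show "?R \<subseteq> ?L" using t by (auto simp: distinct_fiber_pairs_def insert_commute)
      show "?L \<subseteq> ?R"
      proof
        fix p assume pL: "p \<in> ?L"
        obtain u u' v v' where "p = ((u, u'), (v, v'))" by (metis surj_pair)
        then have p: "p = ((u, u'), (v, v'))" "fst u = fst u'" "fst v = fst v'" "fst u \<noteq> fst v"
          "{{u, v}, {u', v'}} = a"
          using pL by (simp_all add: distinct_fiber_pairs_def)
        then have "{u, v} = {s, t} \<and> {u', v'} = {s', t'} \<or> {u, v} = {s', t'} \<and> {u', v'} = {s, t}"
          using t(1) by (simp add: doubleton_eq_iff) 
        then show "p \<in> ?R"
          using p(1-4) t(3-5) by (elim disjE conjE) (auto simp: doubleton_eq_iff)
      qed
    qed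
    moreover have "s \<noteq> t" "s \<noteq> t'" "s' \<noteq> t" "s' \<noteq> t'" using t by metis+
    ultimately show "card {p \<in> ?U. ?f p = a} = 4" using t by simp
  qed
  have UV: "(card ?T)\<^sup>2 = card ?U + card ?V"
  proof -
    have "card (?T \<times> ?T) = card (?U \<union> ?V)" by (rule arg_cong[where f = card]) auto
    also have "\<dots> = card ?U + card ?V" using finT by (intro card_Un_disjoint) auto
    finally show ?thesis by (simp add: card_cartesian_product power2_eq_square)
  qed
  have "card ?V \<le> S 4"
  proof -
    let ?F = "\<lambda>s. {t \<in> H. fst t = fst s}"
    let ?Q = "SIGMA s:H. ?F s \<times> (?F s \<times> ?F s)"
    have finQ: "finite ?Q" using finite_half_edges[of n d] by simp
    have "?V \<subseteq> (\<lambda>(s, s', t, t'). ((s, s'), (t, t'))) ` ?Q"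
      by (force simp: distinct_fiber_pairs_def)
    then have "card ?V \<le> card ?Q" using finQ by (intro surj_card_le)
    also have "\<dots> = (\<Sum>s\<in>H. d (fst s) ^ 3)"
      using finite_half_edges[of n d]
      by (simp add: card_cartesian_product fiber power3_eq_cube mult.assoc)
    also have "\<dots> = S 4"
      using sum_half_edges[of "\<lambda>i. d i ^ 3"]
      by (simp add: degree_power_sum_def power_Suc[symmetric] del: power_Suc)
    finally show ?thesis .
  qed
  then show "4 * card (double_patterns H) \<le> (card ?T)\<^sup>2" "(card ?T)\<^sup>2 \<le> 4 * card (double_patterns H) + S 4"
    using U UV by linarith+
qed

end

section \<open>Asymptotics\<close>

text \<open>With this Lipschitz bound, one mean may replace another in the exponent at the cost of
  their difference.\<close>

lemma abs_exp_minus_diff_le: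
  fixes a b :: real
  assumes "0 \<le> a" "0 \<le> b"
  shows "\<bar>exp (- a) - exp (- b)\<bar> \<le> \<bar>a - b\<bar>"
proof -
  have *: "\<bar>exp (- a) - exp (- b)\<bar> \<le> \<bar>a - b\<bar>" if "0 \<le> a" "a \<le> b" for a b :: real
  proof -
    have "exp (- a) - exp (- b) = exp (- a) * (1 - exp (- (b - a)))"
      by (simp add: algebra_simps flip: exp_add)
    also have "\<dots> \<le> 1 * (1 - exp (- (b - a)))"
      using that by (intro mult_right_mono) auto
    also have "\<dots> \<le> b - a" using exp_ge_add_one_self[of "a - b"]
      by (simp del: exp_ge_add_one_self)
    finally show ?thesis using that by simp
  qed
  show ?thesis using *[of a b] *[of b a] assms by (cases "a \<le> b") (auto simp: abs_minus_commute)
qed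

lemma degree_moment_eq: "n \<ge> 1 \<Longrightarrow> degree_moment k n d = real (degree_power_sum k n d) / real n"
  by (simp add: degree_moment_def degree_power_sum_def integral_pmf_of_set)

lemma (in degree_sequence) nu_nonneg: "nu n d \<ge> 0"
  unfolding nu_def card_distinct_fiber_pairs[symmetric] by (intro divide_nonneg_nonneg) (auto intro: sum_nonneg)

lemma (in even_degree_sequence) lambda_nonneg: "lambda_S n d \<ge> 0" "lambda_M n d \<ge> 0"
  unfolding lambda_S_eq lambda_M_eq by (intro pairing_avg_nonneg; simp)+

text \<open>The three parts of the error, multiplied by \<open>n\<close>, after inserting
  \<open>r \<le> 2 / n\<close> and the bound \<open>C * n\<close> on both power sums; in particular
  \<open>r * S 2 \<le> 2 * C\<close>.\<close>

definition approx_const :: "real \<Rightarrow> real" where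
  "approx_const C = 4 * C * (1 + 2 * C)\<^sup>2 + 64 * C\<^sup>2 * (1 + 2 * C)\<^sup>2 + 8 * C\<^sup>2"

text \<open>Positive degrees give \<open>card H \<ge> n\<close>; then \<open>n \<ge> 16\<close>
  ensures \<open>card H - 7 \<ge> n / 2\<close> as well as the eight half-edges required for
  \<open>k = 2\<close>.\<close>

locale bounded_degree_sequence = even_degree_sequence +
  fixes C :: real
  assumes n: "n \<ge> 16" and pos: "\<And>i. i \<in> {1..n} \<Longrightarrow> d i > 0"
    and S3: "real (S 3) \<le> C * real n"
begin

lemma card_half_edges_ge: "card H \<ge> n"
proof -
  have "(\<Sum>i=1..n. 1) \<le> (\<Sum>i=1..n. d i)" using pos by (intro sum_mono) (simp add: Suc_leI)
  then show ?thesis by (simp add: card_half_edges)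
qed

lemma degree_power_sum_2_le: "real (S 2) \<le> C * real n"
proof -
  have "S 2 \<le> S 3"
    unfolding degree_power_sum_def using pos by (intro sum_mono power_increasing) (auto simp: Suc_leI)
  then show ?thesis using S3 by linarith
qed

lemma C_nonneg: "C \<ge> 0"
proof -
  have "0 \<le> C * real n" using S3 by (rule order_trans[rotated]) simp
  then show ?thesis using n by (simp add: zero_le_mult_iff)
qed

lemma no_pattern_approx:
  assumes A: "A \<subseteq> loop_patterns H \<union> double_patterns H"
  shows "\<bar>pairing_avg H (\<lambda>P. of_bool (pattern_count A P = 0))
      - exp (- pairing_avg H (\<lambda>P. real (pattern_count A P)))\<bar> \<le> approx_const C / real n"
proof -
  have L: "even (card H)" "8 \<le> card H"
    using even_sum card_half_edges_ge n by (auto simp: card_half_edges)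
  interpret pairing_patterns H A 2
    using L A finite_half_edges by (intro pairing_patterns_loops_doubles)
  define r where "r = 1 / (real (card H) - 7)"
  have n0: "real n > 0" using n by simp
  have "real n / 2 \<le> real (card H) - 7" using card_half_edges_ge n by linarith
  then have r: "0 \<le> r" "r \<le> 2 / real n"
    using n0 by (auto simp: r_def field_simps)
  have rn: "r * real n \<le> 2" using r n0 by (simp add: field_simps)
  have rS: "r * real (S 2) \<le> 2 * C"
  proof -
    have "r * real (S 2) \<le> r * (C * real n)" using degree_power_sum_2_le r by (intro mult_left_mono)
    also have "\<dots> = C * (r * real n)" by simp
    also have "\<dots> \<le> C * 2" using rn C_nonneg by (intro mult_left_mono)
    finally show ?thesis by simp
  qed
  have rS0: "0 \<le> r * real (S 2)" using r by simp
  have "\<bar>pairing_avg H (\<lambda>P. of_bool (pattern_count A P = 0))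
      - exp (- pairing_avg H (\<lambda>P. real (pattern_count A P)))\<bar> \<le> error"
    using avg_no_pattern unfolding mean_def .
  also have "\<dots> \<le> r\<^sup>2 * S 3 * (1 + r * S 2)\<^sup>2 + 8 * r * (r * S 2 * (1 + r * S 2))\<^sup>2 + r ^ 3 * (real (S 3))\<^sup>2"
    unfolding r_def by (rule error_half_edges_le[OF L A])
  also have "\<dots> \<le> (2 / real n)\<^sup>2 * (C * real n) * (1 + 2 * C)\<^sup>2
      + 8 * (2 / real n) * (2 * C * (1 + 2 * C))\<^sup>2 + (2 / real n) ^ 3 * (C * real n)\<^sup>2"
  proof -
    define w where "w = r * real (S 2)"
    have w: "0 \<le> w" "w \<le> 2 * C" using rS rS0 by (auto simp: w_def)
    define v where "v = w * (1 + w)"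
    have v: "0 \<le> v" "v \<le> 2 * C * (1 + 2 * C)"
      unfolding v_def using w by (auto intro!: mult_mono)
    show ?thesis
      unfolding w_def[symmetric] v_def[symmetric] using r w v S3 C_nonneg
      by (intro add_mono mult_mono power_mono) auto
  qed
  also have "\<dots> = approx_const C / real n"
    using n0 by (simp add: approx_const_def field_simps power2_eq_square power3_eq_cube)
  finally show ?thesis .
qed

lemma prob_no_loops_approx:
  "\<bar>prob_no_loops n d - exp (- lambda_S n d)\<bar> \<le> approx_const C / real n"
  unfolding prob_no_loops_eq lambda_S_eq by (intro no_pattern_approx) simp

lemma prob_no_multi_edges_approx:
  "\<bar>prob_no_multi_edges n d - exp (- lambda_M n d)\<bar> \<le> approx_const C / real n"
  unfolding prob_no_multi_edges_eq lambda_M_eq by (intro no_pattern_approx) simp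

lemma prob_neither_approx:
  "\<bar>prob_neither n d - exp (- lambda_S n d - lambda_M n d)\<bar> \<le> approx_const C / real n"
proof -
  have "- lambda_S n d - lambda_M n d = - (lambda_S n d + lambda_M n d)" by simp
  then show ?thesis
    unfolding prob_neither_eq lambda_S_plus_lambda_M
    by (simp only:) (intro no_pattern_approx, simp)
qed

abbreviation "F \<equiv> real (card distinct_fiber_pairs)"

lemma nu_eq: "nu n d = F / real (card H)"
  by (simp add: nu_def card_distinct_fiber_pairs card_half_edges)

lemma F_le: "F \<le> C * real n"
proof -
  have "card (distinct_fiber_pairs) \<le> card (fiber_pairs)"
    using finite_fibers by (intro card_mono) (auto simp: distinct_fiber_pairs_def fiber_pairs_def)
  then show ?thesis using degree_power_sum_2_le by (simp add: card_fiber_pairs)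
qed

text \<open>Each loop comes from two ordered pairs, so \<open>lambda_S\<close> is exactly
  \<open>F / (2 * (L - 1))\<close>, against \<open>F / (2 * L)\<close> for \<open>nu / 2\<close>.
  The gap \<open>F / (2 * L * (L - 1))\<close> is small because \<open>F \<le> C * n\<close> and
  \<open>L \<ge> n\<close>.\<close>

lemma lambda_S_approx: "\<bar>lambda_S n d - nu n d / 2\<bar> \<le> C / real n"
proof -
  define L where "L = real (card H)"
  have L: "real n \<le> L" "L \<ge> 16" "real n > 0" using card_half_edges_ge n by (auto simp: L_def)
  have "lambda_S n d = real (card (loop_patterns H)) / (L - 1)"
    using pairing_avg_loops even_sum n card_half_edges_ge
    unfolding lambda_S_eq by (simp add: card_half_edges L_def of_nat_diff)
  moreover have "F = 2 * real (card (loop_patterns H))" by (simp add: card_loop_patterns)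
  ultimately have "lambda_S n d = F / (2 * (L - 1))" by (simp only: mult_divide_mult_cancel_left)
  then have "lambda_S n d - nu n d / 2 = F / (2 * L * (L - 1))"
    using L unfolding nu_eq L_def[symmetric] by (simp add: field_simps)
  moreover have "0 \<le> F / (2 * L * (L - 1))" using L by simp
  moreover have "F / (2 * L * (L - 1)) \<le> (C * real n) / (real n * real n)"
  proof (rule frac_le)
    show "0 \<le> C * real n" using C_nonneg by simp
    have "real n * real n \<le> L * (2 * (L - 1))" using L by (intro mult_mono) auto
    then show "real n * real n \<le> 2 * L * (L - 1)" by (simp add: mult_ac)
  qed (use F_le L in auto)
  ultimately show ?thesis using L by simp
qed

text \<open>Two discrepancies of opposite sign: \<open>(L - 1) * (L - 3)\<close> in place of
  \<open>L ^ 2\<close> makes \<open>lambda_M\<close> larger, and \<open>4 * D\<close> in place of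
  \<open>F ^ 2\<close> makes it smaller. Hence two one-sided bounds, with constants
  \<open>4 * C ^ 2\<close> and \<open>C'\<close>.\<close>

lemma lambda_M_approx:
  assumes S4: "real (S 4) \<le> C' * real n"
  shows "\<bar>lambda_M n d - (nu n d)\<^sup>2 / 4\<bar> \<le> (4 * C\<^sup>2 + C') / real n"
proof -
  define L where "L = real (card H)"
  define D where "D = real (card (double_patterns H))"
  define q where "q = (L - 1) * (L - 3)"
  have L: "real n \<le> L" "L \<ge> 16" "real n > 0" using card_half_edges_ge n by (auto simp: L_def)
  have lam: "lambda_M n d = D / q"
    using pairing_avg_doubles even_sum n card_half_edges_ge
    unfolding lambda_M_eq by (simp add: card_half_edges L_def D_def q_def of_nat_diff)
  have q: "q \<ge> L\<^sup>2 / 4" "q > 0" "q \<le> L\<^sup>2"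
  proof -
    have "(L / 2) * (L / 2) \<le> q" unfolding q_def using L by (intro mult_mono) auto
    then show "q \<ge> L\<^sup>2 / 4" by (simp add: power2_eq_square)
    show "q > 0" unfolding q_def using L by simp
    show "q \<le> L\<^sup>2" using L by (simp add: q_def power2_eq_square algebra_simps)
  qed
  have D: "4 * D \<le> F\<^sup>2" "F\<^sup>2 \<le> 4 * D + real (S 4)"
    using card_double_patterns[THEN of_nat_mono, where 'a = real]
    by (simp_all only: D_def of_nat_power of_nat_add of_nat_mult of_nat_numeral)
  have nu: "(nu n d)\<^sup>2 / 4 = F\<^sup>2 / (4 * L\<^sup>2)"
    by (simp add: nu_eq L_def power_divide)
  have nL: "(real n)\<^sup>2 \<le> L\<^sup>2" using L by (intro power_mono) auto
  have gap: "F\<^sup>2 / (4 * q) - F\<^sup>2 / (4 * L\<^sup>2) \<le> 4 * C\<^sup>2 / real n"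
  proof -
    have "F\<^sup>2 / (4 * q) - F\<^sup>2 / (4 * L\<^sup>2) = F\<^sup>2 * (L\<^sup>2 - q) / (4 * q * L\<^sup>2)"
      using q L by (simp add: field_simps)
    \<comment> \<open>The difference \<open>L ^ 2 - q\<close> equals \<open>4 * L - 3\<close>, and
      \<open>q \<ge> L ^ 2 / 4\<close> takes care of the denominator.\<close>
    also have "\<dots> \<le> F\<^sup>2 * (4 * L) / (4 * (L\<^sup>2 / 4) * L\<^sup>2)"
    proof (rule frac_le)
      show "F\<^sup>2 * (L\<^sup>2 - q) \<le> F\<^sup>2 * (4 * L)"
        by (intro mult_left_mono) (auto simp: q_def power2_eq_square algebra_simps)
      show "4 * (L\<^sup>2 / 4) * L\<^sup>2 \<le> 4 * q * L\<^sup>2"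
        using q by (intro mult_right_mono) auto
    qed (use L in auto)
    also have "\<dots> = 4 * F\<^sup>2 / (L * L\<^sup>2)" using L by (simp add: power2_eq_square)
    also have "\<dots> \<le> 4 * (C * real n)\<^sup>2 / (real n * (real n)\<^sup>2)"
      using F_le L nL by (intro frac_le mult_left_mono power_mono mult_mono) auto
    also have "\<dots> = 4 * C\<^sup>2 / real n" using L by (simp add: field_simps power2_eq_square)
    finally show ?thesis .
  qed
  have "D / q \<le> F\<^sup>2 / (4 * q)" using D q by (simp add: field_simps)
  then have upper: "lambda_M n d - (nu n d)\<^sup>2 / 4 \<le> 4 * C\<^sup>2 / real n"
    unfolding lam nu using gap by linarith
  have "F\<^sup>2 / (4 * L\<^sup>2) \<le> F\<^sup>2 / (4 * q)" using q L by (intro divide_left_mono) auto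
  also have "\<dots> \<le> (4 * D + real (S 4)) / (4 * q)" using D q by (intro divide_right_mono) auto
  also have "\<dots> = D / q + real (S 4) / (4 * q)" using q by (simp add: add_divide_distrib)
  also have "real (S 4) / (4 * q) \<le> (C' * real n) / (real n)\<^sup>2"
  proof (rule frac_le)
    show "(real n)\<^sup>2 \<le> 4 * q" using nL q by linarith
  qed (use S4 L order_trans[OF of_nat_0_le_iff S4] in auto)
  also have "\<dots> = C' / real n" using L by (simp add: power2_eq_square)
  finally have lower: "(nu n d)\<^sup>2 / 4 - lambda_M n d \<le> C' / real n" unfolding lam nu by linarith
  have "0 \<le> C' * real n" using S4 by (rule order_trans[rotated]) simp
  then have "0 \<le> C' / real n" "0 \<le> 4 * C\<^sup>2 / real n" using L by (auto simp: zero_le_mult_iff)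
  then show ?thesis using upper lower unfolding add_divide_distrib by linarith
qed

end

section \<open>From explicit bounds to asymptotics\<close>

lemma bigo_inverseI:
  fixes f :: "nat \<Rightarrow> real"
  assumes "\<And>n. n \<ge> m \<Longrightarrow> \<bar>f n\<bar> \<le> K / real n"
  shows "f \<in> O(\<lambda>n. 1 / real n)"
  using assms by (intro bigoI[where c = K] eventually_at_top_linorderI[of m]) auto

lemma bigo_exp_replace:
  fixes p a b :: "nat \<Rightarrow> real"
  assumes "(\<lambda>n. p n - exp (- a n)) \<in> O(\<lambda>n. 1 / real n)" "(\<lambda>n. a n - b n) \<in> O(\<lambda>n. 1 / real n)"
    and "\<And>n. a n \<ge> 0" "\<And>n. b n \<ge> 0"
  shows "(\<lambda>n. p n - exp (- b n)) \<in> O(\<lambda>n. 1 / real n)"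
proof -
  have "(\<lambda>n. exp (- a n) - exp (- b n)) \<in> O(\<lambda>n. a n - b n)"
    using abs_exp_minus_diff_le assms(3,4) by (intro bigoI[where c = 1]) (simp add: always_eventually)
  then have "(\<lambda>n. exp (- a n) - exp (- b n)) \<in> O(\<lambda>n. 1 / real n)"
    using assms(2) by (rule landau_o.big_trans)
  from sum_in_bigo(1)[OF assms(1) this] show ?thesis by simp
qed

text \<open>A convergent sequence is bounded, which gives one constant for all \<open>n\<close>; for
  \<open>n \<ge> 1\<close> the moment is the power sum divided by \<open>n\<close>.\<close>

lemma degree_moment_bounded:
  assumes "(\<lambda>n. degree_moment k n (d n)) \<longlonglongrightarrow> l"
  obtains C where "\<And>n. n \<ge> 1 \<Longrightarrow> real (degree_power_sum k n (d n)) \<le> C * real n"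
proof -
  from assms have "Bseq (\<lambda>n. degree_moment k n (d n))"
    by (intro convergent_imp_Bseq) (auto simp: convergent_def)
  then obtain C where C: "\<And>n. \<bar>degree_moment k n (d n)\<bar> \<le> C" by (auto simp: Bseq_def)
  have "real (degree_power_sum k n (d n)) \<le> C * real n" if "n \<ge> 1" for n
    using C[of n] that by (simp add: degree_moment_eq field_simps)
  then show thesis by (rule that)
qed

theorem theorem1p5:
  fixes d :: "nat \<Rightarrow> nat \<Rightarrow> nat"
    and \<Omega> :: "'a measure" and D :: "'a \<Rightarrow> real"
  assumes degree_pos: "\<And>n i. i \<in> {1..n} \<Longrightarrow> d n i > 0"
    and degree_sum_even: "\<And>n. even (\<Sum>i=1..n. d n i)"
    and prob: "prob_space \<Omega>"
    and D_rv: "D \<in> borel_measurable \<Omega>"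
    and D_conv: "weak_conv_m (\<lambda>n. degree_law n (d n)) (distr \<Omega> borel D)"
    and D_int1: "integrable \<Omega> D"
    and D_mom1: "(\<lambda>n. degree_moment 1 n (d n)) \<longlonglongrightarrow> (LINT \<omega>|\<Omega>. D \<omega>)"
    and D_int3: "integrable \<Omega> (\<lambda>\<omega>. D \<omega> ^ 3)"
    and D_mom3: "(\<lambda>n. degree_moment 3 n (d n)) \<longlonglongrightarrow> (LINT \<omega>|\<Omega>. D \<omega> ^ 3)"
  shows
    "(\<lambda>n. prob_no_loops n (d n) - exp (- lambda_S n (d n))) \<in> O(\<lambda>n. 1 / real n) \<and>
     (\<lambda>n. prob_no_multi_edges n (d n) - exp (- lambda_M n (d n))) \<in> O(\<lambda>n. 1 / real n) \<and>
     (\<lambda>n. prob_neither n (d n) - exp (- lambda_S n (d n) - lambda_M n (d n)))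
        \<in> O(\<lambda>n. 1 / real n) \<and>
     (\<lambda>n. prob_simple n (d n) - exp (- lambda_S n (d n) - lambda_M n (d n)))
        \<in> O(\<lambda>n. 1 / real n) \<and>
     (integrable \<Omega> (\<lambda>\<omega>. D \<omega> ^ 4) \<and>
      (\<lambda>n. degree_moment 4 n (d n)) \<longlonglongrightarrow> (LINT \<omega>|\<Omega>. D \<omega> ^ 4) \<longrightarrow>
        (\<lambda>n. lambda_S n (d n) - nu n (d n) / 2) \<in> O(\<lambda>n. 1 / real n) \<and>
        (\<lambda>n. lambda_M n (d n) - (nu n (d n))\<^sup>2 / 4) \<in> O(\<lambda>n. 1 / real n) \<and>
        (\<lambda>n. prob_no_loops n (d n) - exp (- (nu n (d n) / 2))) \<in> O(\<lambda>n. 1 / real n) \<and>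
        (\<lambda>n. prob_no_multi_edges n (d n) - exp (- ((nu n (d n))\<^sup>2 / 4)))
           \<in> O(\<lambda>n. 1 / real n) \<and>
        (\<lambda>n. prob_neither n (d n) - exp (- (nu n (d n) / 2) - (nu n (d n))\<^sup>2 / 4))
           \<in> O(\<lambda>n. 1 / real n) \<and>
        (\<lambda>n. prob_simple n (d n) - exp (- (nu n (d n) / 2) - (nu n (d n))\<^sup>2 / 4))
           \<in> O(\<lambda>n. 1 / real n))"
proof -
  let ?O = "O(\<lambda>n. 1 / real n)"
  obtain C where C: "\<And>n. n \<ge> 1 \<Longrightarrow> real (degree_power_sum 3 n (d n)) \<le> C * real n"
    using degree_moment_bounded[OF D_mom3] by blast
  have even: "even_degree_sequence n (d n)" for n
    by unfold_locales (rule degree_sum_even)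
  \<comment> \<open>\<open>C\<close> does not depend on \<open>n\<close>, so the explicit bounds of
    the locale become \<open>O(1 / n)\<close> statements.\<close>
  have bounded: "bounded_degree_sequence n (d n) C" if "n \<ge> 16" for n
    by unfold_locales (use that degree_pos degree_sum_even C in auto)
  have loops: "(\<lambda>n. prob_no_loops n (d n) - exp (- lambda_S n (d n))) \<in> ?O"
    using bounded_degree_sequence.prob_no_loops_approx[OF bounded] by (rule bigo_inverseI[of 16]) auto
  have doubles: "(\<lambda>n. prob_no_multi_edges n (d n) - exp (- lambda_M n (d n))) \<in> ?O"
    using bounded_degree_sequence.prob_no_multi_edges_approx[OF bounded] by (rule bigo_inverseI[of 16]) auto
  have neither: "(\<lambda>n. prob_neither n (d n) - exp (- lambda_S n (d n) - lambda_M n (d n))) \<in> ?O"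
    using bounded_degree_sequence.prob_neither_approx[OF bounded] by (rule bigo_inverseI[of 16]) auto
  have simple: "prob_simple n (d n) = prob_neither n (d n)" for n
    by (rule even_degree_sequence.prob_simple_eq_neither[OF even])
  have nonneg: "lambda_S n (d n) \<ge> 0" "lambda_M n (d n) \<ge> 0" "nu n (d n) \<ge> 0" for n
    using even_degree_sequence.lambda_nonneg[OF even] degree_sequence.nu_nonneg by blast+
  have fourth: "(\<lambda>n. lambda_S n (d n) - nu n (d n) / 2) \<in> ?O \<and>
      (\<lambda>n. lambda_M n (d n) - (nu n (d n))\<^sup>2 / 4) \<in> ?O \<and>
      (\<lambda>n. prob_no_loops n (d n) - exp (- (nu n (d n) / 2))) \<in> ?O \<and>
      (\<lambda>n. prob_no_multi_edges n (d n) - exp (- ((nu n (d n))\<^sup>2 / 4))) \<in> ?O \<and>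
      (\<lambda>n. prob_neither n (d n) - exp (- (nu n (d n) / 2) - (nu n (d n))\<^sup>2 / 4)) \<in> ?O"
    if D_mom4: "(\<lambda>n. degree_moment 4 n (d n)) \<longlonglongrightarrow> (LINT \<omega>|\<Omega>. D \<omega> ^ 4)"
  proof -
    obtain C' where C': "\<And>n. n \<ge> 1 \<Longrightarrow> real (degree_power_sum 4 n (d n)) \<le> C' * real n"
      using degree_moment_bounded[OF D_mom4] by blast
    have S4: "real (degree_power_sum 4 n (d n)) \<le> C' * real n" if "n \<ge> 16" for n
      using C' that by simp
    have lS: "(\<lambda>n. lambda_S n (d n) - nu n (d n) / 2) \<in> ?O"
      using bounded_degree_sequence.lambda_S_approx[OF bounded] by (rule bigo_inverseI[of 16]) auto
    have lM: "(\<lambda>n. lambda_M n (d n) - (nu n (d n))\<^sup>2 / 4) \<in> ?O"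
      using bounded_degree_sequence.lambda_M_approx[OF bounded S4] by (rule bigo_inverseI[of 16]) auto
    have "(\<lambda>n. prob_no_loops n (d n) - exp (- (nu n (d n) / 2))) \<in> ?O"
      by (rule bigo_exp_replace[OF loops lS]) (simp_all add: nonneg)
    moreover have "(\<lambda>n. prob_no_multi_edges n (d n) - exp (- ((nu n (d n))\<^sup>2 / 4))) \<in> ?O"
      by (rule bigo_exp_replace[OF doubles lM]) (simp_all add: nonneg)
    \<comment> \<open>The exponents are written as a negated sum, so that both means are replaced at
      once as a single nonnegative quantity.\<close>
    moreover have "(\<lambda>n. prob_neither n (d n) - exp (- (nu n (d n) / 2 + (nu n (d n))\<^sup>2 / 4))) \<in> ?O"
    proof (rule bigo_exp_replace)
      show "(\<lambda>n. prob_neither n (d n) - exp (- (lambda_S n (d n) + lambda_M n (d n)))) \<in> ?O"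
        using neither by simp
      show "(\<lambda>n. lambda_S n (d n) + lambda_M n (d n) - (nu n (d n) / 2 + (nu n (d n))\<^sup>2 / 4)) \<in> ?O"
        using sum_in_bigo(1)[OF lS lM] by (simp add: algebra_simps)
    qed (simp_all add: nonneg)
    ultimately show ?thesis using lS lM by simp
  qed
  show ?thesis
    unfolding simple using loops doubles neither fourth by blast
qed

end
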